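(* Let $n\ge 2$ and $\lambda,T\in\mathbb{C}$. Define $$Z(\lambda,T):=\sum_{k\ge 0}\sum_{0\le \ell\le n}T^{nk}e^{-\lambda \ell}\,\mathrm{Vol}^{(n)}_{k,\ell}.$$ Then $$Z(\lambda,T)=\frac12\sum_{(\theta_1,\theta_2)\in\{0,1\}^2}(-1)^{(\theta_1+1)(\theta_2+n+1)}\prod_{z^n=(-1)^{\theta_2}}\left(e^{Tz}-(-1)^{\theta_1}e^{-\lambda}\right),$$ where the product is over the $n$ complex solutions $z$ of $z^n=(-1)^{\theta_2}$.
   Context: $\mathbb{Z}_n=\mathbb{Z}/n\mathbb{Z}=\{0,\ldots,n-1\}$ and $\mathbb{T}_n=[0,1)\times\mathbb{Z}_n$ (string $h$ is $[0,1)\times\{h\}$); arithmetic on string labels is mod $n$. Bead configuration: for $k\ge1$, a collection of $nk$ distinct points of $\mathbb{T}_n$ with exactly $k$ points on each string such that for every $h\in\mathbb{Z}_n$, if $t_1<\cdots<t_k$ and $t_1'<\cdots<t_k'$ are the horizontal coordinates of the points on strings $h$ and $h+1$, then either $t_1\le t_1'<t_2\le t_2'<\cdots<t_k\le t_k'$ or $t_1'<t_1\le t_2'<t_2\le\cdots\le t_k'<t_k$. Occupation number: $\ell:=\#\{h\in\mathbb{Z}_n:\ \text{the smallest horizontal coordinate on string }h\text{ is strictly less than that on string }h-1\}$. Volumes: for $k\ge1$ and $0\le\ell\le n$, identify a bead configuration with the array $(t_{h,j})_{0\le h\le n-1,1\le j\le k}\in[0,1)^{nk}$, where $t_{h,j}$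 is the horizontal coordinate of the $j$-th bead (in increasing order) on string $h$, and let $\mathrm{Vol}^{(n)}_{k,\ell}$ be the $nk$-dimensional Lebesgue measure of the set of arrays of bead configurations with $k$ beads per string and occupation number $\ell$. Also $\mathrm{Vol}^{(n)}_{0,\ell}:=\binom{n}{\ell}$ for $0\le\ell\le n$. *)

theory Defs
  imports "HOL-Analysis.Analysis"
begin

text \<open>The labels of the strings are the representatives \<open>0, \<dots>, n - 1\<close> of the residues mod \<open>n\<close>,
  with the cyclic successor and predecessor written out. Strings are \<open>{0..<1} \<times> {h}\<close>.\<close>

definition next_string :: "nat \<Rightarrow> nat \<Rightarrow> nat" where
  "next_string n h = (h + 1) mod n"

definition prev_string :: "nat \<Rightarrow> nat \<Rightarrow> nat" where
  "prev_string n h = (h + n - 1) mod n"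

definition coords :: "(real \<times> nat) set \<Rightarrow> nat \<Rightarrow> real set" where
  "coords B h = {t. (t, h) \<in> B}"

text \<open>Beads on a string are numbered from \<open>0\<close>, so the paper's \<open>t\<^sub>h\<^sub>,\<^sub>j\<close> is \<open>bead_pos B h (j - 1)\<close>.\<close>

definition bead_pos :: "(real \<times> nat) set \<Rightarrow> nat \<Rightarrow> nat \<Rightarrow> real" where
  "bead_pos B h j = sorted_list_of_set (coords B h) ! j"

text \<open>The two alternatives are the chains \<open>t\<^sub>0 \<le> u\<^sub>0 < t\<^sub>1 \<le> u\<^sub>1 < \<dots> < t\<^sub>k\<^sub>-\<^sub>1 \<le> u\<^sub>k\<^sub>-\<^sub>1\<close> and
  \<open>u\<^sub>0 < t\<^sub>0 \<le> u\<^sub>1 < t\<^sub>1 \<le> \<dots> \<le> u\<^sub>k\<^sub>-\<^sub>1 < t\<^sub>k\<^sub>-\<^sub>1\<close>.\<close>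

definition interlacing :: "nat \<Rightarrow> (nat \<Rightarrow> real) \<Rightarrow> (nat \<Rightarrow> real) \<Rightarrow> bool" where
  "interlacing k t u \<longleftrightarrow>
     (\<forall>j<k. t j \<le> u j) \<and> (\<forall>j. j + 1 < k \<longrightarrow> u j < t (j + 1)) \<or>
     (\<forall>j<k. u j < t j) \<and> (\<forall>j. j + 1 < k \<longrightarrow> t j \<le> u (j + 1))"

definition bead_configuration :: "nat \<Rightarrow> nat \<Rightarrow> (real \<times> nat) set \<Rightarrow> bool" where
  "bead_configuration n k B \<longleftrightarrow>
     B \<subseteq> {0..<1} \<times> {0..<n} \<and>
     (\<forall>h<n. finite (coords B h) \<and> card (coords B h) = k) \<and>
     (\<forall>h<n. interlacing k (bead_pos B h) (bead_pos B (next_string n h)))"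

definition occupation_number :: "nat \<Rightarrow> (real \<times> nat) set \<Rightarrow> nat" where
  "occupation_number n B =
     card {h \<in> {0..<n}. Min (coords B h) < Min (coords B (prev_string n h))}"

definition bead_array :: "nat \<Rightarrow> nat \<Rightarrow> (real \<times> nat) set \<Rightarrow> nat \<times> nat \<Rightarrow> real" where
  "bead_array n k B = (\<lambda>(h, j) \<in> {0..<n} \<times> {0..<k}. bead_pos B h j)"

text \<open>The set of arrays is a Borel set, so the finite product of \<open>lborel\<close> gives its
  \<open>n * k\<close>-dimensional Lebesgue measure. The value for \<open>k = 0\<close> is a convention.\<close>

definition Vol :: "nat \<Rightarrow> nat \<Rightarrow> nat \<Rightarrow> real" where
  "Vol n k l =
     (if k = 0 then real (n choose l)
      else measure (Pi\<^sub>M ({0..<n} \<times> {0..<k}) (\<lambda>_. lborel))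
        (bead_array n k ` {B. bead_configuration n k B \<and> occupation_number n B = l}))"

definition Z_term :: "nat \<Rightarrow> complex \<Rightarrow> complex \<Rightarrow> nat \<times> nat \<Rightarrow> complex" where
  "Z_term n lam T = (\<lambda>(k, l). T ^ (n * k) * exp (- lam * of_nat l) * of_real (Vol n k l))"

definition Z :: "nat \<Rightarrow> complex \<Rightarrow> complex \<Rightarrow> complex" where
  "Z n lam T = infsum (Z_term n lam T) (UNIV \<times> {0..n})"

end

theory Submission
  imports Defs
begin

text \<open>
  Read the horizontal coordinate as time and a bead on string \<open>h\<close> as the jump of a particle from
  site \<open>h\<close> to site \<open>h + 1\<close> of the ring of \<open>n\<close> sites. Call site \<open>h\<close> occupied at a given time if the
  next bead on the strings \<open>h - 1\<close> and \<open>h\<close> lies on string \<open>h\<close>. That these two strings interlace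
  means that their beads alternate: a particle leaves \<open>h\<close> only if there is one, and a particle
  arrives at \<open>h\<close> only if \<open>h\<close> is empty. A bead configuration with distinct coordinates is therefore
  a closed walk of the totally asymmetric exclusion process, started with the \<open>l\<close> particles on
  those strings \<open>h\<close> whose first bead precedes the first bead on \<open>h - 1\<close>, together with the times of
  its \<open>n * k\<close> jumps. Only the order of the times is constrained, so every walk contributes the
  volume \<open>1 / (n * k)!\<close>, and \<open>Vol n k l\<close> is the number of closed walks of length \<open>n * k\<close> with \<open>l\<close>
  particles divided by \<open>(n * k)!\<close> (\<open>Vol_eq_walks\<close>). In a closed walk every site emits as many
  particles as it receives, so all closed walks have a length divisible by \<open>n\<close> (\<open>walks_not_dvd\<close>),
  and the sum over \<open>k\<close> is the trace of \<open>exp (T * A)\<close> for the transition matrix \<open>A\<close> of the process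
  with \<open>l\<close> particles.

  This trace is computed by treating the particles as free fermions (\<open>trace_walks\<close>). In a sum over
  independent labelled particles that is antisymmetric in the labels, configurations with two
  particles on one site cancel, so the exclusion rule enforces itself. A particle that jumps from
  \<open>n - 1\<close> to \<open>0\<close> overtakes the \<open>l - 1\<close> others in the linear order of the sites; the resulting sign
  is absorbed by plane waves with momenta \<open>z\<close> such that \<open>z ^ n = (-1) ^ (l + 1)\<close>. The eigenvalues
  of \<open>A\<close> are then the sums of \<open>l\<close> distinct such \<open>z\<close>, and the coefficient of \<open>exp (- lam * l)\<close> in \<open>Z\<close>
  is the elementary symmetric polynomial of degree \<open>l\<close> in the numbers \<open>exp (T * z)\<close>.

  Expanding the products on the right-hand side yields the same polynomials
  (\<open>prod_roots_exp_add\<close>): since the roots sum to \<open>0\<close>, the complement of a set of roots may be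
  replaced by the set of the negatives of its elements. The sum over \<open>\<theta>\<^sub>1\<close> cancels the terms
  whose roots have the wrong sign for their degree.
\<close>

section \<open>Orientation of injective tuples\<close>

text \<open>For an injective tuple this is the sign of the permutation that sorts it. The product over pairs
  shows directly how the sign reacts when a single entry changes.\<close>

definition orientation :: "nat \<Rightarrow> (nat \<Rightarrow> nat) \<Rightarrow> int" where
  "orientation l a = (\<Prod>(i, j) \<in> {(i, j). i < j \<and> j < l}. sgn (int (a j) - int (a i)))"

lemma finite_pairs: "finite {(i, j). i < j \<and> j < (l::nat)}"
  by (rule finite_subset[of _ "{..<l} \<times> {..<l}"]) auto

text \<open>The pairs that the transposition turns around are \<open>(p, q)\<close> and, for every \<open>r\<close> strictly between,
  \<open>(p, r)\<close> and \<open>(r, q)\<close>. Their number is odd, and all other factors are only rearranged.\<close>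

lemma orientation_transpose:
  assumes "p < q" "q < l"
  shows "orientation l (a \<circ> Transposition.transpose p q) = - orientation l a"
proof -
  let ?P = "{(i, j). i < j \<and> j < (l::nat)}"
  let ?t = "Transposition.transpose p q"
  \<comment> \<open>The rearrangement of the factors: transpose both indices, then put them back in increasing order.\<close>
  define srt where "srt = (\<lambda>(i, j). (min (?t i) (?t j), max (?t i) (?t j)))"
  let ?I = "{(i, j) \<in> ?P. ?t j < ?t i}"
  have tl: "?t i < l \<longleftrightarrow> i < l" for i
    using assms by (auto simp: Transposition.transpose_def)
  have tinj: "?t i = ?t j \<longleftrightarrow> i = j" for i j
    by (metis transpose_involutory)
  have "srt (srt x) = x" if "x \<in> ?P" for x
  proof -
    obtain i j where "x = (i, j)" "i < j" using \<open>x \<in> ?P\<close> by auto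
    then show ?thesis by (simp add: srt_def min_def max_def)
  qed
  moreover have "srt x \<in> ?P" if "x \<in> ?P" for x
  proof -
    obtain i j where x: "x = (i, j)" "i < j" "j < l" using \<open>x \<in> ?P\<close> by auto
    then have "?t i \<noteq> ?t j" "?t i < l" "?t j < l" by (simp_all add: tinj tl)
    then show ?thesis by (simp add: srt_def x(1) min_def max_def)
  qed
  ultimately have bij: "bij_betw srt ?P ?P"
    by (intro bij_betwI[where g = srt]) auto
  have I: "?I = insert (p, q) ({p} \<times> {p<..<q} \<union> {p<..<q} \<times> {q})"
  proof (rule set_eqI, clarify)
    fix i j
    show "(i, j) \<in> ?I \<longleftrightarrow> (i, j) \<in> insert (p, q) ({p} \<times> {p<..<q} \<union> {p<..<q} \<times> {q})"
      using assms
      by (cases "i = p"; cases "i = q"; cases "j = p"; cases "j = q") (simp_all add: Transposition.transpose_def, linarith+)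
  qed
  have "card ?I = Suc (2 * card {p<..<q})"
    unfolding I by (subst card_insert_disjoint, simp, force, subst card_Un_disjoint)
      (auto simp: card_cartesian_product)
  then have odd: "odd (card ?I)" by simp
  have "orientation l (a \<circ> ?t) =
    (\<Prod>x\<in>?P. (if x \<in> ?I then -1 else 1) * (case srt x of (i, j) \<Rightarrow> sgn (int (a j) - int (a i))))"
    unfolding orientation_def o_def
  proof (rule prod.cong[OF refl], clarify)
    fix i j :: nat assume ij: "i < j" "j < l"
    have *: "sgn (int x - int y) = - sgn (int y - int x)" for x y
      by (simp add: sgn_if)
    show "sgn (int (a (?t j)) - int (a (?t i))) =
      (if (i, j) \<in> ?I then -1 else 1) * (case srt (i, j) of (i, j) \<Rightarrow> sgn (int (a j) - int (a i)))"
    proof (cases "?t i < ?t j")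
      case True
      then show ?thesis using ij by (simp add: srt_def min_def max_def)
    next
      case False
      then have "?t j < ?t i" using ij tinj[of i j] by linarith
      then show ?thesis using ij *[of "a (?t j)" "a (?t i)"] by (simp add: srt_def min_def max_def)
    qed
  qed
  also have "\<dots> = (\<Prod>x\<in>?P. if x \<in> ?I then -1 else 1) * orientation l a"
    unfolding prod.distrib orientation_def
    using prod.reindex_bij_betw[OF bij, of "\<lambda>(i, j). sgn (int (a j) - int (a i))"] by simp
  also have "(\<Prod>x\<in>?P. if x \<in> ?I then -1 else 1 :: int) = (-1) ^ card ?I"
  proof -
    have "(\<Prod>x\<in>?P. if x \<in> ?I then -1 else 1 :: int) = (\<Prod>x\<in>?I. -1)"
      by (rule prod.mono_neutral_cong_right[OF finite_pairs]) auto
    then show ?thesis by simp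
  qed
  finally show ?thesis unfolding neg_one_odd_power[OF odd] by (simp only: mult_minus_left mult_1)
qed

lemma orientation_permute:
  assumes "\<pi> permutes {..<l}"
  shows "orientation l (a \<circ> \<pi>) = sign \<pi> * orientation l a"
  using finite_lessThan assms
proof (induction rule: permutes_rev_induct)
  case id
  then show ?case by simp
next
  case (swap p q \<pi>)
  have "orientation l ((a \<circ> \<pi>) \<circ> Transposition.transpose p q) = - orientation l (a \<circ> \<pi>)"
    using swap(1-3) orientation_transpose[of p q l "a \<circ> \<pi>"] orientation_transpose[of q p l "a \<circ> \<pi>"]
    by (cases p q rule: linorder_cases) (auto simp: transpose_commute)
  moreover have "sign (\<pi> \<circ> Transposition.transpose p q) = - sign \<pi>"
    using swap(3) permutes_imp_permutation[OF finite_lessThan swap(4)]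
    by (simp add: sign_compose permutation_swap_id sign_swap_id)
  ultimately show ?case using swap.IH by (simp only: o_assoc mult_minus_left)
qed

lemma orientation_square:
  assumes "inj_on a {..<l}"
  shows "orientation l a * orientation l a = 1"
  unfolding orientation_def prod.distrib[symmetric]
proof (rule prod.neutral, clarify)
  fix i j assume "i < j" "j < l"
  then have "a i \<noteq> a j" using assms by (auto dest: inj_onD)
  then show "sgn (int (a j) - int (a i)) * sgn (int (a j) - int (a i)) = 1"
    by (auto simp: sgn_if)
qed

lemma orientation_order_cong:
  assumes "\<And>i j. i < l \<Longrightarrow> j < l \<Longrightarrow> a i < a j \<longleftrightarrow> b i < b j"
  shows "orientation l a = orientation l b"
  unfolding orientation_def
proof (rule prod.cong[OF refl], clarify)
  fix i j assume "i < j" "j < l"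
  then show "sgn (int (a j) - int (a i)) = sgn (int (b j) - int (b i))"
    using assms[of i j] assms[of j i] by (auto simp: sgn_if)
qed

text \<open>The entry that moves from the top to the bottom changes its order with each of the \<open>l - 1\<close> others.\<close>

lemma orientation_wrap:
  assumes i: "i < l" and top: "\<And>j. j < l \<Longrightarrow> j \<noteq> i \<Longrightarrow> a j < a i"
    and bot: "\<And>j. j < l \<Longrightarrow> j \<noteq> i \<Longrightarrow> 0 < a j"
  shows "orientation l (a(i := 0)) = (-1) ^ (l - 1) * orientation l a"
proof -
  let ?P = "{(x, y). x < y \<and> y < l}"
  let ?I = "{(x, y) \<in> ?P. x = i \<or> y = i}"
  have "orientation l (a(i := 0)) = (\<Prod>p\<in>?P. (if p \<in> ?I then -1 else 1) *
      (case p of (x, y) \<Rightarrow> sgn (int (a y) - int (a x))))"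
    unfolding orientation_def
  proof (rule prod.cong[OF refl])
    fix p assume "p \<in> ?P"
    then obtain x y where p: "p = (x, y)" and xy: "x < y" "y < l" by auto
    consider "x = i" "y \<noteq> i" | "y = i" "x \<noteq> i" | "x \<noteq> i" "y \<noteq> i" using xy by blast
    then show "(case p of (x, y) \<Rightarrow> sgn (int ((a(i := 0)) y) - int ((a(i := 0)) x))) =
      (if p \<in> ?I then -1 else 1) * (case p of (x, y) \<Rightarrow> sgn (int (a y) - int (a x)))"
    proof cases
      case 1
      then show ?thesis using xy i top[of y] bot[of y] by (simp add: p)
    next
      case 2
      then show ?thesis using xy i top[of x] bot[of x] by (simp add: p)
    next
      case 3
      then show ?thesis by (simp add: p)
    qed
  qed
  also have "\<dots> = (\<Prod>p\<in>?P. if p \<in> ?I then -1 else 1) * orientation l a"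
    unfolding prod.distrib orientation_def ..
  also have "(\<Prod>p\<in>?P. if p \<in> ?I then -1 else 1 :: int) = (\<Prod>p\<in>?I. -1)"
    by (rule prod.mono_neutral_cong_right[OF finite_pairs]) auto
  also have "?I = {i} \<times> {i<..<l} \<union> {..<i} \<times> {i}"
  proof (rule set_eqI, clarify)
    fix x y
    show "(x, y) \<in> ?I \<longleftrightarrow> (x, y) \<in> {i} \<times> {i<..<l} \<union> {..<i} \<times> {i}"
      using i by (cases "x = i"; cases "y = i") simp_all
  qed
  also have "(\<Prod>p\<in>\<dots>. -1 :: int) = (-1) ^ (l - 1)"
  proof -
    have "card ({i} \<times> {i<..<l} \<union> {..<i} \<times> {i}) = l - 1"
      using i by (subst card_Un_disjoint) (simp_all add: card_cartesian_product disjoint_iff)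
    then show ?thesis by (simp only: prod_constant)
  qed
  finally show ?thesis .
qed

section \<open>Exclusion walks as free fermions\<close>

text \<open>Up to normalisation, the signed number of ways in which \<open>l\<close> independent labelled particles go from
  the positions \<open>a\<close> to a permutation of the positions \<open>c\<close> in \<open>m\<close> steps, one particle advancing per
  step. It is written as an expansion in plane waves: \<open>b\<close> runs over the momenta of the particles, the
  sum of the momenta is the eigenvalue of one step, and the sum over \<open>\<pi>\<close> antisymmetrises.\<close>

definition fermion_sum :: "nat \<Rightarrow> complex set \<Rightarrow> nat \<Rightarrow> (nat \<Rightarrow> nat) \<Rightarrow> (nat \<Rightarrow> nat) \<Rightarrow> complex" where
  "fermion_sum l R m a c = (\<Sum>b \<in> {..<l} \<rightarrow>\<^sub>E R. (\<Sum>i<l. b i) ^ m *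
     (\<Sum>\<pi> | \<pi> permutes {..<l}. of_int (sign \<pi>) * (\<Prod>i<l. b i ^ a i * inverse (b i) ^ c (\<pi> i))))"

lemma bij_betw_precomp_permutation:
  assumes "\<tau> permutes L"
  shows "bij_betw (\<lambda>b. b \<circ> \<tau>) (L \<rightarrow>\<^sub>E R) (L \<rightarrow>\<^sub>E R)"
proof (rule bij_betwI[where g = "\<lambda>b. b \<circ> inv \<tau>"])
  have "b \<circ> \<sigma> \<in> L \<rightarrow>\<^sub>E R" if "b \<in> L \<rightarrow>\<^sub>E R" "\<sigma> permutes L" for b :: "'a \<Rightarrow> 'b" and \<sigma>
    using that by (auto simp: PiE_iff permutes_in_image extensional_def permutes_not_in)
  then show "(\<lambda>b. b \<circ> \<tau>) \<in> (L \<rightarrow>\<^sub>E R) \<rightarrow> (L \<rightarrow>\<^sub>E R)" "(\<lambda>b. b \<circ> inv \<tau>) \<in> (L \<rightarrow>\<^sub>E R) \<rightarrow> (L \<rightarrow>\<^sub>E R)"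
    using assms permutes_inv by blast+
qed (use permutes_inv_o[OF assms] in \<open>auto simp: o_assoc[symmetric]\<close>)

lemma permutes_transpose_lessThan: "i < l \<Longrightarrow> j < l \<Longrightarrow> Transposition.transpose i j permutes {..<l::nat}"
  by (auto intro: permutes_swap_id)

text \<open>The Pauli principle: exchanging the labels \<open>i\<close> and \<open>j\<close> in \<open>b\<close> and \<open>\<pi>\<close> does not move any particle,
  but reverses the sign of \<open>\<pi>\<close>.\<close>

lemma fermion_sum_eq_0:
  assumes "i < l" "j < l" "i \<noteq> j" "a i = a j"
  shows "fermion_sum l R m a c = 0"
proof -
  let ?L = "{..<l}" and ?t = "Transposition.transpose i j"
  let ?F = "\<lambda>b. (\<Sum>i<l. b i) ^ m *
     (\<Sum>\<pi> | \<pi> permutes ?L. of_int (sign \<pi>) * (\<Prod>i<l. b i ^ a i * inverse (b i) ^ c (\<pi> i)))"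
  have t: "?t permutes ?L" using assms by (simp add: permutes_transpose_lessThan)
  have at: "a (?t x) = a x" for x using assms(4) by (auto simp: Transposition.transpose_def)
  have flip: "?F (b \<circ> ?t) = - ?F b" for b
  proof -
    have s: "(\<Sum>i<l. (b \<circ> ?t) i) = (\<Sum>i<l. b i)"
      using sum.permute[OF t, of b] by simp
    have p: "(\<Prod>i<l. (b \<circ> ?t) i ^ a i * inverse ((b \<circ> ?t) i) ^ c (\<pi> i)) =
       (\<Prod>i<l. b i ^ a i * inverse (b i) ^ c ((\<pi> \<circ> ?t) i))" for \<pi>
      using prod.permute[OF t, of "\<lambda>i. (b \<circ> ?t) i ^ a i * inverse ((b \<circ> ?t) i) ^ c (\<pi> i)"]
      by (simp add: at)
    have sg: "sign (\<pi> \<circ> ?t) = - sign \<pi>" if "\<pi> permutes ?L" for \<pi>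
      using assms(3) permutes_imp_permutation[OF finite_lessThan that]
      by (simp add: sign_compose permutation_swap_id sign_swap_id)
    have "(\<Sum>\<pi> | \<pi> permutes ?L. of_int (sign \<pi>) * (\<Prod>i<l. b i ^ a i * inverse (b i) ^ c (\<pi> i)))
      = (\<Sum>\<pi> | \<pi> permutes ?L. of_int (sign (\<pi> \<circ> ?t)) *
           (\<Prod>i<l. b i ^ a i * inverse (b i) ^ c ((\<pi> \<circ> ?t) i)))"
      by (rule sum_permutations_compose_right[OF t])
    also have "\<dots> = (\<Sum>\<pi> | \<pi> permutes ?L. - (of_int (sign \<pi>) *
           (\<Prod>i<l. b i ^ a i * inverse (b i) ^ c ((\<pi> \<circ> ?t) i))))"
      by (rule sum.cong) (auto simp: sg simp del: o_apply)
    finally show ?thesis unfolding s p by (simp add: sum_negf del: o_apply)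
  qed
  have "fermion_sum l R m a c = (\<Sum>b \<in> ?L \<rightarrow>\<^sub>E R. ?F (b \<circ> ?t))"
    unfolding fermion_sum_def
    by (rule sum.reindex_bij_betw[OF bij_betw_precomp_permutation[OF t], symmetric])
  also have "\<dots> = - fermion_sum l R m a c"
    unfolding flip sum_negf fermion_sum_def ..
  finally show ?thesis by simp
qed

text \<open>One more factor \<open>b i\<close> in a plane wave advances the particle \<open>i\<close> by one site.\<close>

lemma fermion_sum_Suc:
  "fermion_sum l R (Suc m) a c = (\<Sum>i<l. fermion_sum l R m (a(i := Suc (a i))) c)"
proof -
  have *: "b i * (\<Prod>j<l. b j ^ a j * inverse (b j) ^ c (\<pi> j)) =
      (\<Prod>j<l. b j ^ (a(i := Suc (a i))) j * inverse (b j) ^ c (\<pi> j))"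
    if "i < l" for b :: "nat \<Rightarrow> complex" and i \<pi>
  proof -
    have i: "i \<in> {..<l}" using that by simp
    show ?thesis
      unfolding prod.remove[OF finite_lessThan i] by (simp add: mult_ac)
  qed
  have "fermion_sum l R (Suc m) a c = (\<Sum>b \<in> {..<l} \<rightarrow>\<^sub>E R. \<Sum>i<l. (\<Sum>i<l. b i) ^ m *
     (\<Sum>\<pi> | \<pi> permutes {..<l}. of_int (sign \<pi>) *
        (\<Prod>j<l. b j ^ (a(i := Suc (a i))) j * inverse (b j) ^ c (\<pi> j))))"
    unfolding fermion_sum_def
  proof (intro sum.cong refl)
    fix b :: "nat \<Rightarrow> complex"
    let ?p = "\<lambda>\<pi>. \<Prod>j<l. b j ^ a j * inverse (b j) ^ c (\<pi> j)"
    have "(\<Sum>i<l. b i) ^ Suc m * (\<Sum>\<pi> | \<pi> permutes {..<l}. of_int (sign \<pi>) * ?p \<pi>) =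
      (\<Sum>i<l. (\<Sum>i<l. b i) ^ m * (\<Sum>\<pi> | \<pi> permutes {..<l}. of_int (sign \<pi>) * (b i * ?p \<pi>)))"
      by (simp add: sum_distrib_left sum_distrib_right mult_ac) (rule sum.swap)
    also have "\<dots> = (\<Sum>i<l. (\<Sum>i<l. b i) ^ m * (\<Sum>\<pi> | \<pi> permutes {..<l}. of_int (sign \<pi>) *
        (\<Prod>j<l. b j ^ (a(i := Suc (a i))) j * inverse (b j) ^ c (\<pi> j))))"
      by (intro sum.cong refl arg_cong2[where f = "(*)"] *) auto
    finally show "(\<Sum>i<l. b i) ^ Suc m * (\<Sum>\<pi> | \<pi> permutes {..<l}. of_int (sign \<pi>) * ?p \<pi>) = \<dots>" .
  qed
  also have "\<dots> = (\<Sum>i<l. fermion_sum l R m (a(i := Suc (a i))) c)"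
    unfolding fermion_sum_def by (rule sum.swap)
  finally show ?thesis .
qed

definition roots :: "nat \<Rightarrow> nat \<Rightarrow> complex set" where
  "roots n e = {z. z ^ n = (-1) ^ e}"

lemma roots_nonzero: "z \<in> roots n e \<Longrightarrow> n > 0 \<Longrightarrow> z \<noteq> 0"
  by (auto simp: roots_def power_0_left)

lemma finite_roots [simp]: "n > 0 \<Longrightarrow> finite (roots n e)"
  by (auto simp: roots_def)

lemma card_roots: "n > 0 \<Longrightarrow> card (roots n e) = n"
  by (simp add: roots_def card_nth_roots)

lemma sum_powers_root_of_unity:
  fixes w :: "'a :: field"
  assumes "w ^ n = 1" "w \<noteq> 1"
  shows "(\<Sum>k<n. w ^ k) = 0"
  using assms geometric_sum[of w n] by simp

lemma sum_powers_quotient_roots: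
  assumes "z \<in> roots n e" "w \<in> roots n e" "n > 0"
  shows "(\<Sum>k<n. z ^ k * inverse w ^ k) = (if z = w then of_nat n else 0)"
proof (cases "z = w")
  case True
  then show ?thesis
    using roots_nonzero[OF assms(2,3)] by (simp add: power_mult_distrib[symmetric])
next
  case False
  have w: "w \<noteq> 0" using roots_nonzero assms by blast
  have "(z * inverse w) ^ n = 1"
    using assms by (simp add: roots_def power_mult_distrib power_inverse)
  moreover have "z * inverse w \<noteq> 1"
    using False w by (simp add: field_simps)
  ultimately show ?thesis
    using sum_powers_root_of_unity[of "z * inverse w" n] False
    by (simp add: power_mult_distrib)
qed

text \<open>Multiplication by a primitive \<open>n\<close>-th root of unity \<open>w\<close> permutes the roots, and it multiplies the sum
  by \<open>w ^ x / w ^ y\<close>, which differs from 1 unless \<open>x = y\<close>.\<close>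

lemma sum_roots_powers:
  assumes "x < n" "y < n"
  shows "(\<Sum>z \<in> roots n e. z ^ x * inverse z ^ y) = (if x = y then of_nat n else 0)"
proof (cases "x = y")
  case True
  then show ?thesis
    using roots_nonzero[of _ n e] assms card_roots[of n e]
    by (simp add: power_mult_distrib[symmetric])
next
  case False
  define w where "w = cis (2 * pi / real n)"
  have wn: "w ^ n = 1"
    using gr_implies_not0[OF assms(1)] by (simp add: w_def Complex.DeMoivre)
  have w0: "w \<noteq> 0" using cis_neq_zero by (simp add: w_def)
  have cw: "w ^ x * inverse w ^ y \<noteq> 1"
  proof
    assume "w ^ x * inverse w ^ y = 1"
    then have "w ^ x = w ^ y" using w0 by (simp add: field_simps power_inverse)
    then have "cis (2 * pi * real x / real n) = cis (2 * pi * real y / real n)"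
      by (simp add: w_def Complex.DeMoivre mult_ac)
    then show False
      using Complex.bij_betw_roots_unity[of n] assms False
      by (auto simp: bij_betw_def dest!: inj_onD)
  qed
  have bij: "bij_betw ((*) w) (roots n e) (roots n e)"
    by (rule bij_betwI[where g = "(*) (inverse w)"])
      (use wn w0 in \<open>auto simp: roots_def power_mult_distrib power_inverse\<close>)
  have "(\<Sum>z \<in> roots n e. z ^ x * inverse z ^ y) = (\<Sum>z \<in> roots n e. (w * z) ^ x * inverse (w * z) ^ y)"
    using sum.reindex_bij_betw[OF bij, of "\<lambda>z. z ^ x * inverse z ^ y"] by simp
  also have "\<dots> = w ^ x * inverse w ^ y * (\<Sum>z \<in> roots n e. z ^ x * inverse z ^ y)"
    by (simp add: power_mult_distrib sum_distrib_left mult_ac)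
  finally show ?thesis using cw False by simp
qed

text \<open>Orthogonality of the plane waves leaves only a permutation that carries \<open>a\<close> to \<open>c\<close>. There is at most
  one, and its sign is the quotient of the orientations.\<close>

lemma fermion_sum_0:
  assumes n: "n > 0"
    and a: "inj_on a {..<l}" "a ` {..<l} \<subseteq> {..<n}" and c: "inj_on c {..<l}" "c ` {..<l} \<subseteq> {..<n}"
  shows "fermion_sum l (roots n e) 0 a c =
    of_nat n ^ l * of_int (orientation l a * orientation l c) * of_bool (a ` {..<l} = c ` {..<l})"
proof -
  let ?L = "{..<l}" and ?R = "roots n e"
  have "fermion_sum l ?R 0 a c =
    (\<Sum>\<pi> | \<pi> permutes ?L. of_int (sign \<pi>) * (\<Sum>b \<in> ?L \<rightarrow>\<^sub>E ?R. \<Prod>i<l. b i ^ a i * inverse (b i) ^ c (\<pi> i)))"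
    unfolding fermion_sum_def by (simp add: sum_distrib_left) (rule sum.swap)
  also have "\<dots> = (\<Sum>\<pi> | \<pi> permutes ?L. of_int (sign \<pi>) *
      (of_nat n ^ l * of_bool (\<forall>i<l. a i = c (\<pi> i))))"
  proof (intro sum.cong refl arg_cong2[where f = "(*)"])
    fix \<pi> assume \<pi>: "\<pi> \<in> {\<pi>. \<pi> permutes ?L}"
    have "(\<Sum>b \<in> ?L \<rightarrow>\<^sub>E ?R. \<Prod>i<l. b i ^ a i * inverse (b i) ^ c (\<pi> i)) =
      (\<Prod>i<l. \<Sum>z \<in> ?R. z ^ a i * inverse z ^ c (\<pi> i))"
      using n by (subst prod_sum_PiE) auto
    also have "\<dots> = (\<Prod>i<l. if a i = c (\<pi> i) then of_nat n else 0)"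
      using a(2) c(2) permutes_in_image[of \<pi> ?L] \<pi>
      by (intro prod.cong refl sum_roots_powers) (auto simp: image_subset_iff)
    also have "\<dots> = of_nat n ^ l * of_bool (\<forall>i<l. a i = c (\<pi> i))"
      by (auto simp: prod_zero_iff)
    finally show "(\<Sum>b \<in> ?L \<rightarrow>\<^sub>E ?R. \<Prod>i<l. b i ^ a i * inverse (b i) ^ c (\<pi> i)) = \<dots>" .
  qed
  also have "\<dots> = of_nat n ^ l * of_int (orientation l a * orientation l c) * of_bool (a ` ?L = c ` ?L)"
  proof (cases "a ` ?L = c ` ?L")
    case False
    have "\<not> (\<forall>i<l. a i = c (\<pi> i))" if "\<pi> permutes ?L" for \<pi>
    proof
      assume "\<forall>i<l. a i = c (\<pi> i)"
      then have "a ` ?L = (c \<circ> \<pi>) ` ?L" by auto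
      then show False using False permutes_image[OF that] by (metis image_comp)
    qed
    then have "(\<Sum>\<pi> | \<pi> permutes ?L. of_int (sign \<pi>) * (of_nat n ^ l * of_bool (\<forall>i<l. a i = c (\<pi> i))))
        = (0 :: complex)"
      by (intro sum.neutral ballI) (simp only: mem_Collect_eq of_bool_eq(1) if_False mult_zero_right simp_thms)
    then show ?thesis using False by simp
  next
    case True
    define \<rho> where "\<rho> = (\<lambda>i. if i < l then inv_into ?L c (a i) else i)"
    have "bij_betw (inv_into ?L c \<circ> a) ?L ?L"
      using a(1) c(1) True by (metis bij_betw_def bij_betw_inv_into bij_betw_trans)
    then have \<rho>: "\<rho> permutes ?L"
      by (intro bij_imp_permutes) (subst bij_betw_cong[of _ _ "inv_into ?L c \<circ> a"], auto simp: \<rho>_def)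
    have c\<rho>: "c (\<rho> i) = a i" if "i < l" for i
      using that True by (auto simp: \<rho>_def intro!: f_inv_into_f)
    have uniq: "\<pi> = \<rho>" if "\<pi> permutes ?L" "\<forall>i<l. a i = c (\<pi> i)" for \<pi>
    proof
      fix i
      show "\<pi> i = \<rho> i"
        using that c\<rho> \<rho> inj_onD[OF c(1), of "\<pi> i" "\<rho> i"]
        permutes_in_image[OF that(1), of i] permutes_in_image[OF \<rho>, of i]
        by (cases "i < l") (auto simp: permutes_not_in)
    qed
    have "orientation l a = orientation l (c \<circ> \<rho>)"
      unfolding orientation_def by (intro prod.cong refl) (auto simp: c\<rho>)
    then have sg: "sign \<rho> = orientation l a * orientation l c"
      using orientation_square[OF c(1)] by (simp add: orientation_permute[OF \<rho>] mult.assoc)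
    have "(\<Sum>\<pi> | \<pi> permutes ?L. of_int (sign \<pi>) * (of_nat n ^ l * of_bool (\<forall>i<l. a i = c (\<pi> i)))) =
      (\<Sum>\<pi> | \<pi> permutes ?L. if \<pi> = \<rho> then of_int (sign \<rho>) * of_nat n ^ l else (0 :: complex))"
    proof (intro sum.cong refl)
      fix \<pi> assume "\<pi> \<in> {\<pi>. \<pi> permutes ?L}"
      then have "(\<forall>i<l. a i = c (\<pi> i)) \<longleftrightarrow> \<pi> = \<rho>" using uniq[of \<pi>] c\<rho> by force
      then show "of_int (sign \<pi>) * (of_nat n ^ l * of_bool (\<forall>i<l. a i = c (\<pi> i))) =
          (if \<pi> = \<rho> then of_int (sign \<rho>) * of_nat n ^ l else (0 :: complex))"
        by simp
    qed
    then show ?thesis using True \<rho> by (simp add: sg mult_ac finite_permutations)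
  qed
  finally show ?thesis .
qed

lemma fermion_sum_wrap:
  assumes "i < l"
  shows "fermion_sum l (roots n e) m (a(i := n)) c = (-1) ^ e * fermion_sum l (roots n e) m (a(i := 0)) c"
proof -
  have i: "i \<in> {..<l}" using assms by simp
  have *: "(\<Prod>j<l. b j ^ (a(i := n)) j * inverse (b j) ^ c (\<pi> j)) =
      (-1) ^ e * (\<Prod>j<l. b j ^ (a(i := 0)) j * inverse (b j) ^ c (\<pi> j))"
    if "b \<in> {..<l} \<rightarrow>\<^sub>E roots n e" for b \<pi>
  proof -
    have "b i ^ n = (-1) ^ e" using that i by (auto simp: roots_def PiE_iff)
    then show ?thesis
      unfolding prod.remove[OF finite_lessThan i] by (simp add: mult_ac)
  qed
  show ?thesis
    unfolding fermion_sum_def sum_distrib_left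
    by (intro sum.cong refl) (simp only: * sum_distrib_left mult.left_commute)
qed

text \<open>The entries of the \<open>m\<close>-th power of the transition matrix of the totally asymmetric exclusion process
  on the ring: sets of occupied sites, with jumps from an occupied \<open>h\<close> to an empty \<open>h + 1\<close>.\<close>

fun walks :: "nat \<Rightarrow> nat \<Rightarrow> nat set \<Rightarrow> nat set \<Rightarrow> nat" where
  "walks n 0 S S' = of_bool (S = S')"
| "walks n (Suc m) S S' =
     (\<Sum>h | h \<in> S \<and> next_string n h \<notin> S. walks n m (insert (next_string n h) (S - {h})) S')"

text \<open>Both sides obey the same recursion in \<open>m\<close>. On the right a jump onto an occupied site contributes
  nothing by the Pauli principle. An allowed jump preserves the orientation unless it leads from
  \<open>n - 1\<close> to \<open>0\<close>; then the orientation changes by \<open>(-1) ^ (l - 1)\<close>, and the choice \<open>l + 1\<close> of the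
  exponent of the roots makes the plane wave change by the same sign.\<close>

lemma walks_eq_fermion_sum:
  assumes n: "n \<ge> 2"
    and a: "inj_on a {..<l}" "a ` {..<l} \<subseteq> {..<n}" and c: "inj_on c {..<l}" "c ` {..<l} \<subseteq> {..<n}"
  shows "of_nat n ^ l * of_nat (walks n m (a ` {..<l}) (c ` {..<l})) =
    of_int (orientation l a * orientation l c) * fermion_sum l (roots n (l + 1)) m a c"
  using a
proof (induction m arbitrary: a)
  case 0
  have "(orientation l a * orientation l c) * (orientation l a * orientation l c) = 1"
    using orientation_square[OF 0(1)] orientation_square[OF c(1)]
    by (metis mult.assoc mult.commute mult_1)
  then have sq: "of_int (orientation l a * orientation l c) * of_int (orientation l a * orientation l c) = (1 :: complex)"
    by (metis of_int_1 of_int_mult)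
  have "fermion_sum l (roots n (l + 1)) 0 a c =
      of_nat n ^ l * of_int (orientation l a * orientation l c) * of_bool (a ` {..<l} = c ` {..<l})"
    using n by (intro fermion_sum_0 0 c) simp
  then have "of_int (orientation l a * orientation l c) * fermion_sum l (roots n (l + 1)) 0 a c =
      (of_int (orientation l a * orientation l c) * of_int (orientation l a * orientation l c)) *
      (of_nat n ^ l * of_bool (a ` {..<l} = c ` {..<l}))"
    by (simp only: mult_ac)
  also have "\<dots> = of_nat n ^ l * of_nat (walks n 0 (a ` {..<l}) (c ` {..<l}))"
    unfolding sq walks.simps of_nat_of_bool by (rule mult_1)
  finally show ?case by (rule sym)
next
  case (Suc m)
  let ?L = "{..<l}" and ?nx = "next_string n" and ?R = "roots n (l + 1)"
  let ?o = "orientation l"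
  have hop: "(if ?nx (a i) \<notin> a ` ?L then of_nat n ^ l *
        of_nat (walks n m (insert (?nx (a i)) (a ` ?L - {a i})) (c ` ?L)) else 0) =
      of_int (?o a * ?o c) * fermion_sum l ?R m (a(i := Suc (a i))) c" if i: "i < l" for i
  proof -
    let ?a = "a(i := ?nx (a i))"
    have ai: "a i < n" using Suc(3) i by auto
    have nx: "?nx (a i) = (if Suc (a i) = n then 0 else Suc (a i))"
      using ai by (auto simp: next_string_def)
    have nx': "?nx (a i) \<noteq> a i" "?nx (a i) < n" using n ai by (auto simp: nx)
    \<comment> \<open>The sign picked up by the plane wave when the position \<open>n\<close> is identified with \<open>0\<close>.\<close>
    define s :: int where "s = (if Suc (a i) = n then (-1) ^ (l + 1) else 1)"
    have fs: "fermion_sum l ?R m (a(i := Suc (a i))) c = of_int s * fermion_sum l ?R m ?a c"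
      using fermion_sum_wrap[OF i, of n "l + 1" m a c] by (simp add: nx s_def)
    show ?thesis
    proof (cases "?nx (a i) \<in> a ` ?L")
      case True
      then obtain j where j: "j < l" "a j = ?nx (a i)" by auto
      then have "fermion_sum l ?R m ?a c = 0"
        using i nx' by (intro fermion_sum_eq_0[of i _ j]) auto
      then show ?thesis using True fs by simp
    next
      case False
      have im: "?a ` ?L = insert (?nx (a i)) (a ` ?L - {a i})"
      proof -
        have "?a ` ?L = insert (?nx (a i)) (a ` (?L - {i}))"
          using i by (auto simp: fun_upd_image)
        also have "a ` (?L - {i}) = a ` ?L - {a i}"
          using i by (simp add: inj_on_image_set_diff[OF Suc(2)])
        finally show ?thesis .
      qed
      have inj: "inj_on ?a ?L"
        using Suc(2) False by (rule inj_on_fun_updI)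
      have "?a ` ?L \<subseteq> {..<n}" using Suc(3) nx' unfolding im by auto
      note IH = Suc.IH[OF inj this, unfolded im]
      have os: "?o ?a = s * ?o a"
      proof (cases "Suc (a i) = n")
        case True
        have "?o (a(i := 0)) = (-1) ^ (l - 1) * ?o a"
        proof (rule orientation_wrap[OF i])
          fix j assume j: "j < l" "j \<noteq> i"
          then show "a j < a i"
            using Suc(3) True inj_onD[OF Suc(2), of j i] i by (force simp: image_subset_iff less_Suc_eq)
          have "0 \<notin> a ` ?L" using False True by (simp add: nx)
          with j show "0 < a j" by (metis gr0I imageI lessThan_iff)
        qed
        moreover have "s = (-1) ^ (l - 1)" using True i by (cases l) (simp_all add: s_def)
        moreover have "?nx (a i) = 0" using True by (simp add: nx)
        ultimately show ?thesis by (simp only:)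
      next
        case F: False
        have "?o ?a = ?o a"
        proof (rule orientation_order_cong)
          fix x y assume xy: "x < l" "y < l"
          have "Suc (a i) \<notin> a ` ?L" using False F by (simp add: nx)
          then have "a z \<noteq> Suc (a i)" "z \<noteq> i \<Longrightarrow> a z \<noteq> a i" if "z < l" for z
            using that inj_onD[OF Suc(2), of z i] i by (force simp: image_iff)+
          from this[OF xy(1)] this[OF xy(2)] show "?a x < ?a y \<longleftrightarrow> a x < a y"
            using F by (auto simp: nx)
        qed
        then show ?thesis using F by (simp add: s_def)
      qed
      have "of_int (?o ?a * ?o c) * fermion_sum l ?R m ?a c =
         of_int (?o a * ?o c) * fermion_sum l ?R m (a(i := Suc (a i))) c"
        unfolding fs os by (simp only: of_int_mult mult_ac)
      then show ?thesis using IH False by (simp only: if_True not_False_eq_True)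
    qed
  qed
  let ?M = "{i \<in> ?L. ?nx (a i) \<notin> a ` ?L}"
  have "{h. h \<in> a ` ?L \<and> ?nx h \<notin> a ` ?L} = a ` ?M" by blast
  moreover have "inj_on a ?M"
    using Suc(2) by (rule inj_on_subset) blast
  ultimately have "walks n (Suc m) (a ` ?L) (c ` ?L) =
     (\<Sum>i\<in>?M. walks n m (insert (?nx (a i)) (a ` ?L - {a i})) (c ` ?L))"
    by (simp only: walks.simps sum.reindex o_def)
  then have "of_nat n ^ l * of_nat (walks n (Suc m) (a ` ?L) (c ` ?L)) =
     (\<Sum>i\<in>?M. of_nat n ^ l * of_nat (walks n m (insert (?nx (a i)) (a ` ?L - {a i})) (c ` ?L)) :: complex)"
    by (simp only: of_nat_sum sum_distrib_left)
  also have "\<dots> = (\<Sum>i<l. if ?nx (a i) \<notin> a ` ?L then of_nat n ^ l *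
        of_nat (walks n m (insert (?nx (a i)) (a ` ?L - {a i})) (c ` ?L)) else 0)"
    by (rule sum.inter_filter[OF finite_lessThan])
  also have "\<dots> = of_int (?o a * ?o c) * fermion_sum l ?R (Suc m) a c"
    unfolding fermion_sum_Suc sum_distrib_left by (rule sum.cong[OF refl]) (rule hop, simp only: lessThan_iff)
  finally show ?case .
qed

lemma sum_injective_tuples:
  fixes f :: "'a set \<Rightarrow> complex"
  assumes A: "finite A"
  shows "(\<Sum>a | a \<in> {..<l::nat} \<rightarrow>\<^sub>E A \<and> inj_on a {..<l}. f (a ` {..<l})) =
    fact l * (\<Sum>S | S \<subseteq> A \<and> card S = l. f S)"
proof -
  let ?L = "{..<l}"
  let ?T = "{a. a \<in> ?L \<rightarrow>\<^sub>E A \<and> inj_on a ?L}"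
  have finT: "finite ?T" by (rule finite_subset[OF _ finite_PiE[of ?L "\<lambda>_. A"]]) (use A in auto)
  have im: "a ` ?L \<in> {S. S \<subseteq> A \<and> card S = l}" if "a \<in> ?T" for a
  proof -
    from that have "inj_on a ?L" "a ` ?L \<subseteq> A" by (auto simp: PiE_iff)
    then show ?thesis by (simp add: card_image)
  qed
  have "(\<Sum>a\<in>?T. f (a ` ?L)) =
      (\<Sum>S | S \<subseteq> A \<and> card S = l. \<Sum>a | a \<in> ?T \<and> a ` ?L = S. f (a ` ?L))"
  proof (rule sum.group[symmetric, OF finT])
    show "finite {S. S \<subseteq> A \<and> card S = l}" using A by simp
    show "(\<lambda>a. a ` ?L) ` ?T \<subseteq> {S. S \<subseteq> A \<and> card S = l}"
      by (rule image_subsetI) (rule im)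
  qed
  also have "\<dots> = (\<Sum>S | S \<subseteq> A \<and> card S = l. fact l * f S)"
  proof (intro sum.cong refl)
    fix S assume S: "S \<in> {S. S \<subseteq> A \<and> card S = l}"
    then have fS: "finite S" "S \<subseteq> A" "card S = l" using A finite_subset by auto
    have "{a. a \<in> ?T \<and> a ` ?L = S} = {a \<in> ?L \<rightarrow>\<^sub>E S. inj_on a ?L}" (is "?X = ?Y")
    proof (intro set_eqI iffI)
      fix a assume "a \<in> ?Y"
      then have a: "a \<in> ?L \<rightarrow>\<^sub>E S" "inj_on a ?L" by simp_all
      then have "a ` ?L \<subseteq> S" by (simp add: PiE_iff image_subset_iff)
      moreover have "card (a ` ?L) = card S" using a(2) fS(3) by (simp add: card_image)
      ultimately have "a ` ?L = S" using fS(1) card_subset_eq by blast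
      moreover have "a \<in> ?L \<rightarrow>\<^sub>E A" using a(1) fS(2) by (meson PiE_mono subsetD)
      ultimately show "a \<in> ?X" using a(2) by simp
    next
      fix a assume "a \<in> ?X"
      then have a: "a \<in> ?L \<rightarrow>\<^sub>E A" "inj_on a ?L" "a ` ?L = S" by simp_all
      then have "a \<in> ?L \<rightarrow>\<^sub>E S" by (simp add: PiE_iff image_subset_iff[symmetric])
      then show "a \<in> ?Y" using a(2) by simp
    qed
    moreover have "card ?Y = fact l"
      using fS by (subst card_inj_on_subset_funcset) (simp_all add: fact_prod_rev atLeast0LessThan)
    ultimately have c: "card ?X = fact l" by simp
    have "(\<Sum>a | a \<in> ?T \<and> a ` ?L = S. f (a ` ?L)) = (\<Sum>a\<in>?X. f S)"
      by (rule sum.cong) simp_all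
    then show "(\<Sum>a | a \<in> ?T \<and> a ` ?L = S. f (a ` ?L)) = fact l * f S"
      by (simp only: sum_constant c of_nat_fact)
  qed
  finally show ?thesis by (simp only: sum_distrib_left)
qed

text \<open>If \<open>b\<close> takes the same value at \<open>i\<close> and \<open>j\<close>, composition with the transposition of \<open>i\<close> and \<open>j\<close> pairs
  terms of opposite sign.\<close>

lemma sum_signs_fixing:
  fixes l :: nat
  assumes b: "b \<in> {..<l} \<rightarrow>\<^sub>E R"
  shows "(\<Sum>\<pi> | \<pi> permutes {..<l}. of_int (sign \<pi>) * of_bool (\<forall>i<l. b i = b (\<pi> i))) =
    (of_bool (inj_on b {..<l}) :: complex)"
proof (cases "inj_on b {..<l}")
  case True
  have "(\<forall>i<l. b i = b (\<pi> i)) \<longleftrightarrow> \<pi> = id" if \<pi>: "\<pi> permutes {..<l}" for \<pi>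
  proof
    assume *: "\<forall>i<l. b i = b (\<pi> i)"
    show "\<pi> = id"
    proof
      fix i show "\<pi> i = id i"
        using * permutes_in_image[OF \<pi>, of i] permutes_not_in[OF \<pi>, of i] inj_onD[OF True, of "\<pi> i" i]
        by (cases "i < l") simp_all
    qed
  qed simp
  then have "(\<Sum>\<pi> | \<pi> permutes {..<l}. of_int (sign \<pi>) * of_bool (\<forall>i<l. b i = b (\<pi> i))) =
    (\<Sum>\<pi> | \<pi> permutes {..<l}. if \<pi> = id then 1 else (0 :: complex))"
    by (intro sum.cong refl) (simp add: id_def[symmetric])
  also have "\<dots> = 1"
    by (subst sum.delta[OF finite_permutations[OF finite_lessThan]]) (simp add: permutes_id)
  finally show ?thesis using True by simp
next
  case False
  then obtain i j where ij: "i < l" "j < l" "i \<noteq> j" "b i = b j" by (auto simp: inj_on_def)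
  let ?t = "Transposition.transpose i j"
  have t: "?t permutes {..<l}" using ij by (simp add: permutes_transpose_lessThan)
  have bt: "b (?t x) = b x" for x using ij(4) by (auto simp: Transposition.transpose_def)
  have sg: "sign (?t \<circ> \<pi>) = - sign \<pi>" if "\<pi> permutes {..<l}" for \<pi>
    using ij(3) permutes_imp_permutation[OF finite_lessThan that]
    by (simp add: sign_compose permutation_swap_id sign_swap_id)
  let ?g = "\<lambda>\<pi>. of_int (sign \<pi>) * of_bool (\<forall>i<l. b i = b (\<pi> i)) :: complex"
  have "(\<Sum>\<pi> | \<pi> permutes {..<l}. ?g \<pi>) = (\<Sum>\<pi> | \<pi> permutes {..<l}. ?g (?t \<circ> \<pi>))"
    by (rule setum_permutations_compose_left[OF t])
  also have "\<dots> = (\<Sum>\<pi> | \<pi> permutes {..<l}. - ?g \<pi>)"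
    by (intro sum.cong refl) (simp only: sg mem_Collect_eq o_apply bt of_int_minus mult_minus_left)
  finally show ?thesis using False by (simp only: sum_negf) simp
qed

text \<open>Here the positions are summed first. This gives the orthogonality of plane waves with different
  momenta, so that a permutation contributes only if it fixes the tuple of momenta. Hence repeated
  momenta cancel, and a tuple of distinct momenta retains only the identity.\<close>

lemma sum_fermion_sum_diagonal:
  assumes n: "n > 0"
  shows "(\<Sum>a \<in> {..<l} \<rightarrow>\<^sub>E {..<n}. fermion_sum l (roots n e) m a a) =
    of_nat n ^ l * (\<Sum>b | b \<in> {..<l} \<rightarrow>\<^sub>E roots n e \<and> inj_on b {..<l}. (\<Sum>i<l. b i) ^ m)"
proof -
  let ?L = "{..<l}" and ?R = "roots n e"
  let ?P = "{\<pi>. \<pi> permutes ?L}"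
  have "(\<Sum>a \<in> ?L \<rightarrow>\<^sub>E {..<n}. fermion_sum l ?R m a a) =
    (\<Sum>b \<in> ?L \<rightarrow>\<^sub>E ?R. \<Sum>a \<in> ?L \<rightarrow>\<^sub>E {..<n}. (\<Sum>i<l. b i) ^ m *
     (\<Sum>\<pi>\<in>?P. of_int (sign \<pi>) * (\<Prod>i<l. b i ^ a i * inverse (b i) ^ a (\<pi> i))))"
    unfolding fermion_sum_def by (rule sum.swap)
  also have "\<dots> = (\<Sum>b \<in> ?L \<rightarrow>\<^sub>E ?R. (\<Sum>i<l. b i) ^ m * (of_nat n ^ l * of_bool (inj_on b ?L)))"
  proof (intro sum.cong refl)
    fix b assume b: "b \<in> ?L \<rightarrow>\<^sub>E ?R"
    have *: "(\<Sum>a \<in> ?L \<rightarrow>\<^sub>E {..<n}. \<Prod>i<l. b i ^ a i * inverse (b i) ^ a (\<pi> i)) =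
        of_nat n ^ l * of_bool (\<forall>i<l. b i = b (inv \<pi> i))" if \<pi>: "\<pi> permutes ?L" for \<pi>
    proof -
      have "(\<Prod>i<l. b i ^ a i * inverse (b i) ^ a (\<pi> i)) =
          (\<Prod>i<l. b i ^ a i * inverse (b (inv \<pi> i)) ^ a i)" for a
        unfolding prod.distrib
        using prod.permute[OF permutes_inv[OF \<pi>], of "\<lambda>i. inverse (b i) ^ a (\<pi> i)"]
        by (simp add: permutes_inverses[OF \<pi>] o_def)
      then have "(\<Sum>a \<in> ?L \<rightarrow>\<^sub>E {..<n}. \<Prod>i<l. b i ^ a i * inverse (b i) ^ a (\<pi> i)) =
          (\<Prod>i<l. \<Sum>k<n. b i ^ k * inverse (b (inv \<pi> i)) ^ k)"
        by (simp add: prod_sum_PiE)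
      also have "\<dots> = (\<Prod>i<l. if b i = b (inv \<pi> i) then of_nat n else 0)"
      proof (intro prod.cong refl sum_powers_quotient_roots n)
        fix i assume "i \<in> ?L"
        then show "b i \<in> ?R" "b (inv \<pi> i) \<in> ?R"
          using b permutes_in_image[OF permutes_inv[OF \<pi>], of i] by (auto simp: PiE_iff)
      qed
      also have "\<dots> = of_nat n ^ l * of_bool (\<forall>i<l. b i = b (inv \<pi> i))"
        by (cases "\<forall>i<l. b i = b (inv \<pi> i)") (auto simp: prod_zero_iff)
      finally show ?thesis .
    qed
    have "(\<Sum>a \<in> ?L \<rightarrow>\<^sub>E {..<n}. \<Sum>\<pi>\<in>?P. of_int (sign \<pi>) * (\<Prod>i<l. b i ^ a i * inverse (b i) ^ a (\<pi> i))) =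
      (\<Sum>\<pi>\<in>?P. of_int (sign \<pi>) * (\<Sum>a \<in> ?L \<rightarrow>\<^sub>E {..<n}. \<Prod>i<l. b i ^ a i * inverse (b i) ^ a (\<pi> i)))"
      unfolding sum_distrib_left by (rule sum.swap)
    also have "\<dots> = (\<Sum>\<pi>\<in>?P. of_int (sign (inv \<pi>)) *
        (of_nat n ^ l * of_bool (\<forall>i<l. b i = b (inv \<pi> i))))"
      using permutes_imp_permutation[OF finite_lessThan]
      by (intro sum.cong refl) (simp only: * mem_Collect_eq sign_inverse)
    also have "\<dots> = (\<Sum>\<pi>\<in>?P. of_int (sign \<pi>) * (of_nat n ^ l * of_bool (\<forall>i<l. b i = b (\<pi> i))))"
      by (rule sum_permutations_inverse[symmetric])
    also have "\<dots> = of_nat n ^ l * (\<Sum>\<pi>\<in>?P. of_int (sign \<pi>) * of_bool (\<forall>i<l. b i = b (\<pi> i)))"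
      unfolding sum_distrib_left by (simp only: mult.left_commute)
    also have "\<dots> = of_nat n ^ l * of_bool (inj_on b ?L)"
      unfolding sum_signs_fixing[OF b] ..
    finally show "(\<Sum>a \<in> ?L \<rightarrow>\<^sub>E {..<n}. (\<Sum>i<l. b i) ^ m *
       (\<Sum>\<pi>\<in>?P. of_int (sign \<pi>) * (\<Prod>i<l. b i ^ a i * inverse (b i) ^ a (\<pi> i)))) =
       (\<Sum>i<l. b i) ^ m * (of_nat n ^ l * of_bool (inj_on b ?L))"
      unfolding sum_distrib_left[symmetric] by (rule arg_cong)
  qed
  also have "\<dots> = (\<Sum>b | b \<in> ?L \<rightarrow>\<^sub>E ?R \<and> inj_on b ?L. of_nat n ^ l * (\<Sum>i<l. b i) ^ m)"
    using finite_PiE[of ?L "\<lambda>_. ?R"] n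
    by (intro sum.mono_neutral_cong_right) (auto simp del: prod_constant)
  finally show ?thesis by (simp only: sum_distrib_left)
qed

text \<open>Tuples with a repeated entry may be included in the trace because their amplitude vanishes. Once all
  tuples are summed, the diagonal sum applies, and the factors \<open>l!\<close> for the labellings of a set of
  positions and of a set of momenta cancel.\<close>

theorem trace_walks:
  assumes n: "n \<ge> 2"
  shows "of_nat (\<Sum>S | S \<subseteq> {..<n} \<and> card S = l. walks n m S S) =
    (\<Sum>B | B \<subseteq> roots n (l + 1) \<and> card B = l. (\<Sum>B) ^ m)"
proof -
  let ?L = "{..<l}" and ?R = "roots n (l + 1)"
  let ?T = "{a. a \<in> ?L \<rightarrow>\<^sub>E {..<n} \<and> inj_on a ?L}"
  have n0: "n > 0" using n by simp
  have "of_nat n ^ l * (fact l * of_nat (\<Sum>S | S \<subseteq> {..<n} \<and> card S = l. walks n m S S)) =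
     of_nat n ^ l * (\<Sum>a\<in>?T. of_nat (walks n m (a ` ?L) (a ` ?L)) :: complex)"
    using sum_injective_tuples[of "{..<n}" "\<lambda>S. of_nat (walks n m S S)" l] by simp
  also have "\<dots> = (\<Sum>a\<in>?T. fermion_sum l ?R m a a)"
    unfolding sum_distrib_left
  proof (intro sum.cong refl)
    fix a assume "a \<in> ?T"
    then have a: "inj_on a ?L" "a ` ?L \<subseteq> {..<n}" by (auto simp: PiE_iff)
    show "of_nat n ^ l * of_nat (walks n m (a ` ?L) (a ` ?L)) = fermion_sum l ?R m a a"
      using walks_eq_fermion_sum[OF n a a, of m] orientation_square[OF a(1)] by simp
  qed
  also have "\<dots> = (\<Sum>a \<in> ?L \<rightarrow>\<^sub>E {..<n}. fermion_sum l ?R m a a)"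
  proof (rule sum.mono_neutral_left)
    show "finite (?L \<rightarrow>\<^sub>E {..<n})" by (simp add: finite_PiE)
    show "\<forall>a \<in> (?L \<rightarrow>\<^sub>E {..<n}) - ?T. fermion_sum l ?R m a a = 0"
    proof
      fix a assume "a \<in> (?L \<rightarrow>\<^sub>E {..<n}) - ?T"
      then have "\<not> inj_on a ?L" by simp
      then obtain i j where "i < l" "j < l" "i \<noteq> j" "a i = a j" by (auto simp: inj_on_def)
      then show "fermion_sum l ?R m a a = 0" by (rule fermion_sum_eq_0)
    qed
  qed simp
  also have "\<dots> = of_nat n ^ l * (\<Sum>b | b \<in> ?L \<rightarrow>\<^sub>E ?R \<and> inj_on b ?L. (\<Sum>i<l. b i) ^ m)"
    by (rule sum_fermion_sum_diagonal[OF n0])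
  also have "(\<Sum>b | b \<in> ?L \<rightarrow>\<^sub>E ?R \<and> inj_on b ?L. (\<Sum>i<l. b i) ^ m) =
      (\<Sum>b | b \<in> ?L \<rightarrow>\<^sub>E ?R \<and> inj_on b ?L. (\<Sum>(b ` ?L)) ^ m)"
    by (intro sum.cong refl) (simp add: sum.reindex)
  also have "\<dots> = fact l * (\<Sum>B | B \<subseteq> ?R \<and> card B = l. (\<Sum>B) ^ m)"
    using n0 by (intro sum_injective_tuples) simp
  finally show ?thesis using n0 by simp
qed

section \<open>Sets determined by the order of the coordinates\<close>

abbreviation lebesgue_on_arrays :: "'i set \<Rightarrow> ('i \<Rightarrow> real) measure" where
  "lebesgue_on_arrays I \<equiv> Pi\<^sub>M I (\<lambda>_. lborel)"

lemma product_sigma_finite_lborel: "product_sigma_finite (\<lambda>_. lborel)"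
  by (simp add: product_sigma_finite_def lborel.sigma_finite_measure_axioms)

lemma emeasure_lebesgue_on_arrays_PiE:
  assumes "finite I" "\<And>i. i \<in> I \<Longrightarrow> A i \<in> sets borel"
  shows "emeasure (lebesgue_on_arrays I) (Pi\<^sub>E I A) = (\<Prod>i\<in>I. emeasure lborel (A i))"
  using assms by (intro product_sigma_finite.emeasure_PiM[OF product_sigma_finite_lborel]) auto

text \<open>For an injective \<open>\<sigma>\<close>, the simplex of arrays in the cube whose coordinates are ordered as the values of \<open>\<sigma>\<close>.\<close>

definition order_simplex :: "'i set \<Rightarrow> ('i \<Rightarrow> nat) \<Rightarrow> ('i \<Rightarrow> real) set" where
  "order_simplex I \<sigma> = {x \<in> I \<rightarrow>\<^sub>E {0..<1}. \<forall>i\<in>I. \<forall>j\<in>I. \<sigma> i < \<sigma> j \<longrightarrow> x i < x j}"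

definition rankings :: "'i set \<Rightarrow> ('i \<Rightarrow> nat) set" where
  "rankings I = {\<sigma> \<in> I \<rightarrow>\<^sub>E {..<card I}. inj_on \<sigma> I}"

lemma sets_cube: "finite I \<Longrightarrow> I \<rightarrow>\<^sub>E {0..<1} \<in> sets (lebesgue_on_arrays I)"
  by (intro sets_PiM_I_finite) auto

lemma measurable_coordinate_less:
  assumes "finite I" "i \<in> I" "j \<in> I"
  shows "{x \<in> space (lebesgue_on_arrays I). x i < x j} \<in> sets (lebesgue_on_arrays I)"
proof -
  have "(\<lambda>x. x k) \<in> borel_measurable (lebesgue_on_arrays I)" if "k \<in> I" for k
    using measurable_component_singleton[OF that, of "\<lambda>_. lborel"] by simp
  then show ?thesis using assms by (intro borel_measurable_less) auto
qed

lemma sets_order_simplex: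
  assumes "finite I"
  shows "order_simplex I \<sigma> \<in> sets (lebesgue_on_arrays I)"
proof -
  have eq: "order_simplex I \<sigma> = (I \<rightarrow>\<^sub>E {0..<1}) \<inter>
    {x \<in> space (lebesgue_on_arrays I). \<forall>i\<in>I. \<forall>j\<in>I. \<sigma> i < \<sigma> j \<longrightarrow> x i < x j}"
    by (auto simp: order_simplex_def space_PiM)
  have "{x \<in> space (lebesgue_on_arrays I). \<forall>i\<in>I. \<forall>j\<in>I. \<sigma> i < \<sigma> j \<longrightarrow> x i < x j} \<in> sets (lebesgue_on_arrays I)"
    using assms by (intro sets.sets_Collect_finite_All sets.sets_Collect_imp measurable_coordinate_less) auto
  then show ?thesis unfolding eq using sets_cube[OF assms] by (rule sets.Int[rotated])
qed

text \<open>The diagonal of the unit square in the coordinates \<open>i\<close> and \<open>j\<close> is covered by \<open>m\<close> squares of side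
  \<open>1 / m\<close>, which have total area \<open>1 / m\<close>.\<close>

lemma null_ties:
  assumes I: "finite I" and ij: "i \<in> I" "j \<in> I" "i \<noteq> j"
  shows "{x \<in> I \<rightarrow>\<^sub>E {0..<1}. x i = x j} \<in> null_sets (lebesgue_on_arrays I)"
proof -
  let ?M = "lebesgue_on_arrays I"
  let ?T = "{x \<in> I \<rightarrow>\<^sub>E {0..<1 :: real}. x i = x j}"
  have "{x \<in> C. x i = x j} = C - {x \<in> X. x i < x j} - {x \<in> X. x j < x i}"
    if "C \<subseteq> X" for C X :: "('a \<Rightarrow> real) set"
    using that by auto
  from this[OF sets.sets_into_space[OF sets_cube[OF I]]]
  have "?T = (I \<rightarrow>\<^sub>E {0..<1}) - {x \<in> space ?M. x i < x j} - {x \<in> space ?M. x j < x i}" .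
  then have T: "?T \<in> sets ?M"
    using sets_cube[OF I] measurable_coordinate_less[OF I ij(1,2)] measurable_coordinate_less[OF I ij(2,1)]
    by (auto intro: sets.Diff)
  have "emeasure ?M ?T \<le> ennreal (1 / real m)" if m: "m > 0" for m
  proof -
    define E where "E r = (\<Pi>\<^sub>E k\<in>I. if k \<in> {i, j} then {real r / m..<(real r + 1) / m} else {0..<1})" for r
    have E: "emeasure ?M (E r) = ennreal (1 / m) ^ 2" for r
    proof -
      have "emeasure ?M (E r) =
          (\<Prod>k\<in>I. emeasure lborel (if k \<in> {i, j} then {real r / m..<(real r + 1) / m} else {0..<1}))"
        unfolding E_def by (rule emeasure_lebesgue_on_arrays_PiE[OF I]) simp
      also have "\<dots> = (\<Prod>k\<in>I. if k \<in> {i, j} then ennreal (1 / m) else 1)"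
      proof (rule prod.cong[OF refl])
        fix k
        have "emeasure lborel {real r / m..<(real r + 1) / m} = ennreal (1 / m)"
          using m by (subst emeasure_lborel_Ico) (simp_all add: divide_right_mono add_divide_distrib)
        then show "emeasure lborel (if k \<in> {i, j} then {real r / m..<(real r + 1) / m} else {0..<1}) =
            (if k \<in> {i, j} then ennreal (1 / m) else 1)" by simp
      qed
      also have "\<dots> = (\<Prod>k\<in>{i, j}. ennreal (1 / m))"
        using I ij by (subst prod.inter_restrict[symmetric]) (simp_all add: Int_absorb1)
      also have "\<dots> = ennreal (1 / m) ^ 2" using ij by (simp add: power2_eq_square)
      finally show ?thesis .
    qed
    have "?T \<subseteq> (\<Union>r<m. E r)"
    proof
      fix x assume x: "x \<in> ?T"
      define r where "r = nat \<lfloor>x i * m\<rfloor>"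
      have xi: "0 \<le> x i" "x i < 1" using x ij by (auto simp: PiE_iff)
      have r: "real r \<le> x i * m" "x i * m < real r + 1"
        using xi m by (simp_all add: r_def)
      have "real r < m" using r(1) xi m by (smt (verit) mult_less_cancel_right2 of_nat_0_less_iff)
      moreover have "x \<in> E r"
        using x r m by (auto simp: E_def PiE_iff field_simps)
      ultimately show "x \<in> (\<Union>r<m. E r)" by auto
    qed
    then have "emeasure ?M ?T \<le> emeasure ?M (\<Union>r<m. E r)"
      using I by (intro emeasure_mono sets.finite_UN) (auto simp: E_def intro!: sets_PiM_I_finite)
    also have "\<dots> \<le> (\<Sum>r<m. emeasure ?M (E r))"
      using I by (intro emeasure_subadditive_finite) (auto simp: E_def intro!: sets_PiM_I_finite)
    also have "\<dots> = ennreal (real m * (1 / real m) ^ 2)"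
      by (simp add: E ennreal_power ennreal_mult ennreal_of_nat_eq_real_of_nat)
    also have "\<dots> = ennreal (1 / m)" using m by (simp add: power2_eq_square)
    finally show ?thesis .
  qed
  then have *: "emeasure ?M ?T \<le> ennreal (1 / real (Suc m))" for m by blast
  have "(\<lambda>m. ennreal (1 / real (Suc m))) \<longlonglongrightarrow> ennreal 0"
    by (intro tendsto_ennrealI LIMSEQ_Suc lim_1_over_n)
  then have "emeasure ?M ?T \<le> ennreal 0"
    by (rule LIMSEQ_le_const) (use * in blast)
  then show ?thesis using T by (intro null_setsI) auto
qed

lemma rankings_bij_betw:
  assumes "finite I" "\<sigma> \<in> rankings I"
  shows "bij_betw \<sigma> I {..<card I}"
  using assms card_subset_eq[of "{..<card I}" "\<sigma> ` I"]
  by (auto simp: rankings_def bij_betw_def card_image PiE_iff image_subset_iff)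

lemma ranking_eq_card:
  assumes \<sigma>: "\<sigma> \<in> rankings I" and I: "finite I" and i: "i \<in> I"
  shows "\<sigma> i = card {j \<in> I. \<sigma> j < \<sigma> i}"
proof -
  have inj: "inj_on \<sigma> I" and onto: "\<sigma> ` I = {..<card I}"
    using rankings_bij_betw[OF I \<sigma>] by (simp_all add: bij_betw_def)
  have "\<sigma> i < card I" using onto i by auto
  then have "\<sigma> ` {j \<in> I. \<sigma> j < \<sigma> i} = {..<\<sigma> i}"
  proof (intro set_eqI iffI)
    fix r assume "r \<in> {..<\<sigma> i}"
    then have "r \<in> \<sigma> ` I" using onto \<open>\<sigma> i < card I\<close> by simp
    then show "r \<in> \<sigma> ` {j \<in> I. \<sigma> j < \<sigma> i}" using \<open>r \<in> {..<\<sigma> i}\<close> by auto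
  qed auto
  moreover have "inj_on \<sigma> {j \<in> I. \<sigma> j < \<sigma> i}" using inj by (rule inj_on_subset) blast
  ultimately show ?thesis by (metis card_image card_lessThan)
qed

lemma order_simplex_less_iff:
  assumes "x \<in> order_simplex I \<sigma>" "\<sigma> \<in> rankings I" "i \<in> I" "j \<in> I"
  shows "x i < x j \<longleftrightarrow> \<sigma> i < \<sigma> j"
proof -
  have *: "\<sigma> i < \<sigma> j \<Longrightarrow> x i < x j" "\<sigma> j < \<sigma> i \<Longrightarrow> x j < x i"
    using assms by (auto simp: order_simplex_def)
  have "\<sigma> i = \<sigma> j \<Longrightarrow> i = j" using assms by (auto simp: rankings_def dest: inj_onD)
  with * show ?thesis by (cases "\<sigma> i" "\<sigma> j" rule: linorder_cases) auto
qed

lemma order_simplex_inj_on: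
  assumes "x \<in> order_simplex I \<sigma>" "\<sigma> \<in> rankings I"
  shows "inj_on x I"
proof (rule inj_onI)
  fix i j assume ij: "i \<in> I" "j \<in> I" "x i = x j"
  have "\<sigma> i = \<sigma> j"
    using order_simplex_less_iff[OF assms ij(1,2)] order_simplex_less_iff[OF assms ij(2,1)] ij(3) by simp
  then show "i = j" using assms(2) ij by (auto simp: rankings_def dest: inj_onD)
qed

lemma disjoint_order_simplices:
  assumes "finite I" "\<sigma> \<in> rankings I" "\<tau> \<in> rankings I" "x \<in> order_simplex I \<sigma>" "x \<in> order_simplex I \<tau>"
  shows "\<sigma> = \<tau>"
proof
  fix i
  show "\<sigma> i = \<tau> i"
  proof (cases "i \<in> I")
    case True
    have "{j \<in> I. \<sigma> j < \<sigma> i} = {j \<in> I. \<tau> j < \<tau> i}"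
      using order_simplex_less_iff[OF assms(4,2)] order_simplex_less_iff[OF assms(5,3)] True by blast
    then show ?thesis using ranking_eq_card assms(1-3) True by metis
  next
    case False
    then show ?thesis using assms(2,3) by (auto simp: rankings_def PiE_iff extensional_def)
  qed
qed

lemma ex_order_simplex:
  assumes I: "finite I" and x: "x \<in> I \<rightarrow>\<^sub>E {0..<1}" "inj_on x I"
  shows "\<exists>\<sigma>\<in>rankings I. x \<in> order_simplex I \<sigma>"
proof -
  define \<sigma> where "\<sigma> = (\<lambda>i\<in>I. card {j \<in> I. x j < x i})"
  have mono: "\<sigma> i < \<sigma> j" if "i \<in> I" "j \<in> I" "x i < x j" for i j
  proof -
    have "{k \<in> I. x k < x i} \<subset> {k \<in> I. x k < x j}" using that by force
    then show ?thesis using that I by (simp add: \<sigma>_def psubset_card_mono)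
  qed
  have less: "\<sigma> i < \<sigma> j \<longleftrightarrow> x i < x j" if "i \<in> I" "j \<in> I" for i j
    using mono[OF that] mono[OF that(2,1)] inj_onD[OF x(2) _ that]
    by (cases "x i" "x j" rule: linorder_cases) auto
  have "inj_on \<sigma> I"
  proof (rule inj_onI)
    fix i j assume "i \<in> I" "j \<in> I" "\<sigma> i = \<sigma> j"
    then have "x i = x j" using less[of i j] less[of j i] by (metis less_irrefl linorder_neqE)
    then show "i = j" using inj_onD[OF x(2)] \<open>i \<in> I\<close> \<open>j \<in> I\<close> by blast
  qed
  moreover have "\<sigma> i < card I" if "i \<in> I" for i
  proof -
    have "{j \<in> I. x j < x i} \<subset> I" using that by auto
    then show ?thesis using that I by (simp add: \<sigma>_def psubset_card_mono)
  qed
  ultimately have "\<sigma> \<in> rankings I" by (simp add: rankings_def PiE_iff \<sigma>_def)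
  moreover have "x \<in> order_simplex I \<sigma>" using x less by (simp add: order_simplex_def)
  ultimately show ?thesis by blast
qed

lemma finite_rankings: "finite I \<Longrightarrow> finite (rankings I)"
  by (rule finite_subset[OF _ finite_PiE[of I "\<lambda>_. {..<card I}"]]) (auto simp: rankings_def)

lemma card_rankings:
  assumes "finite I"
  shows "card (rankings I) = fact (card I)"
  unfolding rankings_def using assms
  by (subst card_inj_on_subset_funcset) (simp_all add: fact_prod_rev)

lemma distr_reindex_lebesgue:
  assumes I: "finite I" and \<pi>: "bij_betw \<pi> I I"
  shows "distr (lebesgue_on_arrays I) (lebesgue_on_arrays I) (\<lambda>x. \<lambda>i\<in>I. x (\<pi> i)) = lebesgue_on_arrays I"
    (is "distr ?M ?M ?T = ?M")
proof (rule product_sigma_finite.PiM_eqI[OF product_sigma_finite_lborel I])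
  show "sets (distr ?M ?M ?T) = sets ?M" by simp
  fix A :: "'a \<Rightarrow> real set" assume A: "\<And>i. i \<in> I \<Longrightarrow> A i \<in> sets lborel"
  have meas: "?T \<in> measurable ?M ?M"
    using bij_betwE[OF \<pi>] by (intro measurable_restrict measurable_component_singleton) auto
  define \<rho> where "\<rho> = inv_into I \<pi>"
  have \<rho>: "bij_betw \<rho> I I" unfolding \<rho>_def by (rule bij_betw_inv_into[OF \<pi>])
  have \<rho>\<pi>: "\<rho> (\<pi> i) = i" "\<pi> (\<rho> i) = i" if "i \<in> I" for i
    using that \<pi> by (simp_all add: \<rho>_def bij_betw_inv_into_left bij_betw_inv_into_right)
  have pre: "?T -` Pi\<^sub>E I A \<inter> space ?M = (\<Pi>\<^sub>E k\<in>I. A (\<rho> k))"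
  proof (intro set_eqI iffI)
    fix x assume x: "x \<in> ?T -` Pi\<^sub>E I A \<inter> space ?M"
    then have ext: "x \<in> extensional I" and mem: "\<And>i. i \<in> I \<Longrightarrow> x (\<pi> i) \<in> A i"
      by (auto simp: space_PiM PiE_iff)
    have "x k \<in> A (\<rho> k)" if "k \<in> I" for k
      using mem[of "\<rho> k"] \<rho>\<pi>(2)[OF that] bij_betwE[OF \<rho>] that by simp
    then show "x \<in> (\<Pi>\<^sub>E k\<in>I. A (\<rho> k))"
      using ext by (simp add: PiE_iff)
  next
    fix x assume x: "x \<in> (\<Pi>\<^sub>E k\<in>I. A (\<rho> k))"
    have "x (\<pi> i) \<in> A i" if "i \<in> I" for i
      using PiE_mem[OF x, of "\<pi> i"] \<rho>\<pi>(1)[OF that] bij_betwE[OF \<pi>] that by simp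
    then show "x \<in> ?T -` Pi\<^sub>E I A \<inter> space ?M"
      using x by (auto simp: space_PiM PiE_iff)
  qed
  have "emeasure (distr ?M ?M ?T) (Pi\<^sub>E I A) = emeasure ?M (\<Pi>\<^sub>E k\<in>I. A (\<rho> k))"
    using A I by (subst emeasure_distr[OF meas]) (auto simp: pre intro!: sets_PiM_I_finite)
  also have "\<dots> = (\<Prod>k\<in>I. emeasure lborel (A (\<rho> k)))"
    using A bij_betwE[OF \<rho>] by (intro emeasure_lebesgue_on_arrays_PiE[OF I]) auto
  also have "\<dots> = (\<Prod>k\<in>I. emeasure lborel (A k))"
    by (rule prod.reindex_bij_betw[OF \<rho>])
  finally show "emeasure (distr ?M ?M ?T) (Pi\<^sub>E I A) = (\<Prod>k\<in>I. emeasure lborel (A k))" .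
qed

text \<open>Any two rankings differ by a permutation of the coordinates, which preserves the measure.\<close>

lemma measure_order_simplex_eq:
  assumes I: "finite I" and \<sigma>: "\<sigma> \<in> rankings I" and \<tau>: "\<tau> \<in> rankings I"
  shows "measure (lebesgue_on_arrays I) (order_simplex I \<sigma>) = measure (lebesgue_on_arrays I) (order_simplex I \<tau>)"
proof -
  let ?M = "lebesgue_on_arrays I"
  note bij = rankings_bij_betw[OF I]
  define \<pi> where "\<pi> = inv_into I \<tau> \<circ> \<sigma>"
  have \<pi>: "bij_betw \<pi> I I"
    unfolding \<pi>_def by (rule bij_betw_trans[OF bij[OF \<sigma>] bij_betw_inv_into[OF bij[OF \<tau>]]])
  have \<tau>\<pi>: "\<tau> (\<pi> i) = \<sigma> i" if "i \<in> I" for i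
    using that bij_betwE[OF bij[OF \<sigma>]] bij_betw_inv_into_right[OF bij[OF \<tau>]] by (simp add: \<pi>_def)
  let ?T = "\<lambda>x. \<lambda>i\<in>I. x (\<pi> i)"
  have meas: "?T \<in> measurable ?M ?M"
    using bij_betwE[OF \<pi>] by (intro measurable_restrict measurable_component_singleton) auto
  have "?T -` order_simplex I \<sigma> \<inter> space ?M = order_simplex I \<tau>"
  proof (intro set_eqI iffI)
    fix x assume "x \<in> ?T -` order_simplex I \<sigma> \<inter> space ?M"
    then have x: "x \<in> extensional I" "\<And>i. i \<in> I \<Longrightarrow> x (\<pi> i) \<in> {0..<1}"
      "\<And>i j. i \<in> I \<Longrightarrow> j \<in> I \<Longrightarrow> \<sigma> i < \<sigma> j \<Longrightarrow> x (\<pi> i) < x (\<pi> j)"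
      by (auto simp: space_PiM PiE_iff order_simplex_def)
    have ex: "\<exists>i\<in>I. \<pi> i = k" if "k \<in> I" for k
      using that bij_betw_imp_surj_on[OF \<pi>] by (metis imageE)
    show "x \<in> order_simplex I \<tau>"
      unfolding order_simplex_def mem_Collect_eq PiE_iff
    proof (intro conjI ballI impI x(1))
      fix k assume "k \<in> I" then show "x k \<in> {0..<1}" using x(2) ex by blast
    next
      fix k k' assume "k \<in> I" "k' \<in> I" "\<tau> k < \<tau> k'"
      then show "x k < x k'" using x(3) ex \<tau>\<pi> by metis
    qed
  next
    fix x assume "x \<in> order_simplex I \<tau>"
    then show "x \<in> ?T -` order_simplex I \<sigma> \<inter> space ?M"
      using bij_betwE[OF \<pi>] \<tau>\<pi> by (auto simp: space_PiM PiE_iff order_simplex_def)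
  qed
  then have "emeasure (distr ?M ?M ?T) (order_simplex I \<sigma>) = emeasure ?M (order_simplex I \<tau>)"
    by (subst emeasure_distr[OF meas]) (simp_all add: sets_order_simplex[OF I])
  then show ?thesis unfolding distr_reindex_lebesgue[OF I \<pi>] by (simp add: measure_def)
qed

text \<open>Outside the null set of arrays with ties, the cube is the disjoint union of the order simplices, one
  for each of the \<open>N!\<close> rankings of the \<open>N\<close> coordinates. They all have the same volume, hence volume
  \<open>1 / N!\<close>, and a property that depends on the order alone holds on a union of such simplices.\<close>

theorem measure_order_invariant:
  fixes P :: "('i \<Rightarrow> real) \<Rightarrow> bool"
  assumes I: "finite I"
    and meas: "{x \<in> I \<rightarrow>\<^sub>E {0..<1}. P x} \<in> sets (lebesgue_on_arrays I)"
    and P: "\<And>x y. inj_on x I \<Longrightarrow> inj_on y I \<Longrightarrow> (\<And>i j. i \<in> I \<Longrightarrow> j \<in> I \<Longrightarrow> x i < x j \<longleftrightarrow> y i < y j)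
      \<Longrightarrow> P x \<Longrightarrow> P y"
  shows "measure (lebesgue_on_arrays I) {x \<in> I \<rightarrow>\<^sub>E {0..<1}. P x} =
    card {\<sigma> \<in> rankings I. P (\<lambda>i. real (\<sigma> i))} / fact (card I)"
proof -
  let ?M = "lebesgue_on_arrays I"
  define ties where "ties = (\<Union>(i, j) \<in> {(i, j) \<in> I \<times> I. i \<noteq> j}. {x \<in> I \<rightarrow>\<^sub>E {0..<1 :: real}. x i = x j})"
  have ties: "ties \<in> null_sets ?M"
    unfolding ties_def
    using null_ties[OF I] finite_subset[of "{(i, j) \<in> I \<times> I. i \<noteq> j}" "I \<times> I"] I
    by (intro null_sets_UN' countable_finite) auto
  have cube: "emeasure ?M (I \<rightarrow>\<^sub>E {0..<1}) = 1"
    using emeasure_lebesgue_on_arrays_PiE[OF I, of "\<lambda>_. {0..<1}"] by simp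
  have sum: "measure ?M {x \<in> I \<rightarrow>\<^sub>E {0..<1}. Q x} =
      (\<Sum>\<sigma> | \<sigma> \<in> rankings I \<and> Q (\<lambda>i. real (\<sigma> i)). measure ?M (order_simplex I \<sigma>))"
    if meas: "{x \<in> I \<rightarrow>\<^sub>E {0..<1}. Q x} \<in> sets ?M"
    and Q: "\<And>x y. inj_on x I \<Longrightarrow> inj_on y I \<Longrightarrow> (\<And>i j. i \<in> I \<Longrightarrow> j \<in> I \<Longrightarrow> x i < x j \<longleftrightarrow> y i < y j)
      \<Longrightarrow> Q x \<Longrightarrow> Q y" for Q
  proof -
    have Qiff: "Q x \<longleftrightarrow> Q (\<lambda>i. real (\<sigma> i))" if "x \<in> order_simplex I \<sigma>" "\<sigma> \<in> rankings I" for x \<sigma>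
    proof -
      have 1: "inj_on x I" using that by (rule order_simplex_inj_on)
      have 2: "inj_on (\<lambda>i. real (\<sigma> i)) I" using that(2) by (auto simp: rankings_def inj_on_def)
      have 3: "x i < x j \<longleftrightarrow> real (\<sigma> i) < real (\<sigma> j)" if "i \<in> I" "j \<in> I" for i j
        using order_simplex_less_iff[OF \<open>x \<in> order_simplex I \<sigma>\<close> \<open>\<sigma> \<in> rankings I\<close> that] by simp
      show ?thesis using Q[OF 1 2 3] Q[OF 2 1 3[symmetric]] by blast
    qed
    have "measure ?M {x \<in> I \<rightarrow>\<^sub>E {0..<1}. Q x} = measure ?M ({x \<in> I \<rightarrow>\<^sub>E {0..<1}. Q x} - ties)"
      using measure_Diff_null_set[OF meas ties] by simp
    also have "{x \<in> I \<rightarrow>\<^sub>E {0..<1}. Q x} - ties =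
        (\<Union>\<sigma>\<in>{\<sigma>. \<sigma> \<in> rankings I \<and> Q (\<lambda>i. real (\<sigma> i))}. order_simplex I \<sigma>)"
    proof (intro set_eqI iffI)
      fix x assume x: "x \<in> {x \<in> I \<rightarrow>\<^sub>E {0..<1}. Q x} - ties"
      then have x': "x \<in> I \<rightarrow>\<^sub>E {0..<1}" "Q x" by auto
      have "inj_on x I" using x x'(1) unfolding ties_def inj_on_def by blast
      then show "x \<in> (\<Union>\<sigma>\<in>{\<sigma>. \<sigma> \<in> rankings I \<and> Q (\<lambda>i. real (\<sigma> i))}. order_simplex I \<sigma>)"
        using ex_order_simplex[OF I x'(1)] Qiff x'(2) by blast
    next
      fix x assume "x \<in> (\<Union>\<sigma>\<in>{\<sigma>. \<sigma> \<in> rankings I \<and> Q (\<lambda>i. real (\<sigma> i))}. order_simplex I \<sigma>)"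
      then obtain \<sigma> where \<sigma>: "\<sigma> \<in> rankings I" "Q (\<lambda>i. real (\<sigma> i))" "x \<in> order_simplex I \<sigma>" by blast
      have "x \<in> I \<rightarrow>\<^sub>E {0..<1}" using \<sigma>(3) by (simp add: order_simplex_def)
      moreover have "Q x" using Qiff \<sigma> by blast
      moreover have "x \<notin> ties"
        using order_simplex_inj_on[OF \<sigma>(3,1)] by (auto simp: ties_def dest: inj_onD)
      ultimately show "x \<in> {x \<in> I \<rightarrow>\<^sub>E {0..<1}. Q x} - ties" by blast
    qed
    also have "measure ?M \<dots> = (\<Sum>\<sigma> | \<sigma> \<in> rankings I \<and> Q (\<lambda>i. real (\<sigma> i)). measure ?M (order_simplex I \<sigma>))"
    proof (rule measure_finite_Union)
      show "finite {\<sigma>. \<sigma> \<in> rankings I \<and> Q (\<lambda>i. real (\<sigma> i))}" using finite_rankings[OF I] by simp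
      show "order_simplex I ` {\<sigma>. \<sigma> \<in> rankings I \<and> Q (\<lambda>i. real (\<sigma> i))} \<subseteq> sets ?M"
        using sets_order_simplex[OF I] by blast
      show "disjoint_family_on (order_simplex I) {\<sigma>. \<sigma> \<in> rankings I \<and> Q (\<lambda>i. real (\<sigma> i))}"
        using disjoint_order_simplices[OF I] unfolding disjoint_family_on_def by blast
      fix \<sigma>
      have "emeasure ?M (order_simplex I \<sigma>) \<le> 1"
        unfolding cube[symmetric] by (rule emeasure_mono) (auto simp: order_simplex_def sets_cube[OF I])
      then show "emeasure ?M (order_simplex I \<sigma>) \<noteq> \<infinity>" by (auto simp: top_unique)
    qed
    finally show ?thesis .
  qed
  obtain \<sigma>\<^sub>0 where \<sigma>\<^sub>0: "\<sigma>\<^sub>0 \<in> rankings I"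
    using card_rankings[OF I] by (metis card.empty fact_nonzero ex_in_conv)
  have const: "measure ?M (order_simplex I \<sigma>) = measure ?M (order_simplex I \<sigma>\<^sub>0)" if "\<sigma> \<in> rankings I" for \<sigma>
    using measure_order_simplex_eq[OF I that \<sigma>\<^sub>0] .
  have "1 = measure ?M {x \<in> I \<rightarrow>\<^sub>E {0..<1}. True}"
    using cube by (simp add: measure_def)
  also have "\<dots> = (\<Sum>\<sigma> \<in> rankings I. measure ?M (order_simplex I \<sigma>))"
    using sets_cube[OF I] by (subst sum) simp_all
  also have "\<dots> = fact (card I) * measure ?M (order_simplex I \<sigma>\<^sub>0)"
    by (simp add: const card_rankings[OF I])
  finally have "measure ?M (order_simplex I \<sigma>\<^sub>0) = 1 / fact (card I)"
    by (simp add: field_simps)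
  then show ?thesis using sum[OF meas P] const by simp
qed

section \<open>Words of jumps and occupancies of sites\<close>

text \<open>A word lists the sites from which the successive jumps start.\<close>

fun reaches :: "nat \<Rightarrow> nat set \<Rightarrow> nat list \<Rightarrow> nat set \<Rightarrow> bool" where
  "reaches n S [] S' \<longleftrightarrow> S = S'"
| "reaches n S (h # w) S' \<longleftrightarrow> h \<in> S \<and> next_string n h \<notin> S \<and> reaches n (insert (next_string n h) (S - {h})) w S'"

lemma next_string_less: "h < n \<Longrightarrow> next_string n h < n"
  by (simp add: next_string_def)

lemma next_string_neq: "n \<ge> 2 \<Longrightarrow> h < n \<Longrightarrow> next_string n h \<noteq> h"
  by (cases "h + 1 = n") (auto simp: next_string_def)

lemma prev_string_eq: "h < n \<Longrightarrow> prev_string n h = (if h = 0 then n - 1 else h - 1)"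
  by (auto simp: prev_string_def mod_if)

lemma next_string_eq: "h < n \<Longrightarrow> next_string n h = (if h + 1 = n then 0 else h + 1)"
  by (auto simp: next_string_def)

lemma prev_string_less: "h < n \<Longrightarrow> prev_string n h < n"
  by (simp add: prev_string_def)

lemma next_prev_string: "h < n \<Longrightarrow> next_string n (prev_string n h) = h"
  by (subst next_string_eq) (auto simp: prev_string_eq)

lemma prev_next_string: "h < n \<Longrightarrow> prev_string n (next_string n h) = h"
  by (subst prev_string_eq) (auto simp: next_string_eq)

lemma prev_string_eq_iff: "g < n \<Longrightarrow> h < n \<Longrightarrow> prev_string n g = h \<longleftrightarrow> g = next_string n h"
  using next_prev_string prev_next_string by metis

lemma prev_string_neq: "n \<ge> 2 \<Longrightarrow> h < n \<Longrightarrow> prev_string n h \<noteq> h"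
  using next_string_neq prev_string_eq_iff by metis

lemma card_reaches:
  assumes "finite S"
  shows "finite {w. length w = m \<and> reaches n S w S'} \<and>
    card {w. length w = m \<and> reaches n S w S'} = walks n m S S'"
  using assms
proof (induction m arbitrary: S)
  case 0
  have "{w. length w = 0 \<and> reaches n S w S'} = (if S = S' then {[]} else {})" by auto
  then show ?case by simp
next
  case (Suc m)
  let ?H = "{h. h \<in> S \<and> next_string n h \<notin> S}"
  let ?W = "\<lambda>h. {w. length w = m \<and> reaches n (insert (next_string n h) (S - {h})) w S'}"
  have eq: "{w. length w = Suc m \<and> reaches n S w S'} = (\<Union>h\<in>?H. (#) h ` ?W h)"
  proof (intro set_eqI iffI)
    fix w assume "w \<in> {w. length w = Suc m \<and> reaches n S w S'}"
    then show "w \<in> (\<Union>h\<in>?H. (#) h ` ?W h)" by (cases w) auto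
  qed auto
  have IH: "finite (?W h)" "card (?W h) = walks n m (insert (next_string n h) (S - {h})) S'" for h
    using Suc.IH[of "insert (next_string n h) (S - {h})"] Suc.prems by simp_all
  have H: "finite ?H" using Suc.prems by simp
  have "card (\<Union>h\<in>?H. (#) h ` ?W h) = (\<Sum>h\<in>?H. card ((#) h ` ?W h))"
    using H IH(1) by (intro card_UN_disjoint) auto
  also have "\<dots> = (\<Sum>h\<in>?H. walks n m (insert (next_string n h) (S - {h})) S')"
    by (intro sum.cong refl) (simp add: card_image IH(2))
  finally show ?case unfolding eq using H IH(1) by auto
qed

text \<open>The number of particles on site \<open>g\<close> after \<open>t\<close> jumps if no rule is enforced: arrivals come from the
  preceding site.\<close>

definition occupancy :: "nat \<Rightarrow> nat set \<Rightarrow> nat list \<Rightarrow> nat \<Rightarrow> nat \<Rightarrow> int" where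
  "occupancy n S w t g = of_bool (g \<in> S) + int (count_list (take t w) (prev_string n g)) - int (count_list (take t w) g)"

lemma occupancy_0 [simp]: "occupancy n S w 0 g = of_bool (g \<in> S)"
  by (simp add: occupancy_def)

lemma occupancy_Cons:
  assumes n: "n \<ge> 2" and h: "h < n" "h \<in> S" "next_string n h \<notin> S" and g: "g < n"
  shows "occupancy n S (h # w) (Suc t) g = occupancy n (insert (next_string n h) (S - {h})) w t g"
proof -
  have "prev_string n g = h \<longleftrightarrow> g = next_string n h" using prev_string_eq_iff g h by simp
  moreover have "next_string n h \<noteq> h" using next_string_neq n h by simp
  ultimately show ?thesis
    using h by (cases "g = h"; cases "g = next_string n h") (auto simp: occupancy_def)
qed

text \<open>The exclusion rule can be checked site by site. The first forbidden jump is visible in the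
  occupancies: a jump from an empty site makes its occupancy \<open>-1\<close>, and a jump onto an occupied site
  makes the occupancy of the target 2.\<close>

lemma reaches_iff_occupancy:
  assumes n: "n \<ge> 2" and S: "S \<subseteq> {..<n}"
  shows "reaches n S w S' \<longleftrightarrow> set w \<subseteq> {..<n} \<and> S' \<subseteq> {..<n} \<and>
    (\<forall>g<n. (\<forall>t\<le>length w. occupancy n S w t g \<in> {0, 1}) \<and> occupancy n S w (length w) g = of_bool (g \<in> S'))"
  using S
proof (induction w arbitrary: S)
  case Nil
  have "S = S' \<longleftrightarrow> S' \<subseteq> {..<n} \<and> (\<forall>g<n. (g \<in> S) = (g \<in> S'))" using Nil by blast
  then show ?case by (simp add: of_bool_eq_iff)
next
  case (Cons h w)
  let ?S = "insert (next_string n h) (S - {h})"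
  show ?case
  proof (cases "h < n \<and> h \<in> S \<and> next_string n h \<notin> S")
    case True
    have sub: "?S \<subseteq> {..<n}" using Cons.prems True next_string_less by auto
    have occ: "occupancy n S (h # w) (Suc t) g = occupancy n ?S w t g" if "g < n" for t g
      using occupancy_Cons[OF n] True that by blast
    have all: "(\<forall>t\<le>length (h # w). occupancy n S (h # w) t g \<in> {0, 1}) \<longleftrightarrow>
        (\<forall>t\<le>length w. occupancy n ?S w t g \<in> {0, 1})" if "g < n" for g
    proof -
      have "(\<forall>t\<le>Suc (length w). occupancy n S (h # w) t g \<in> {0, 1}) \<longleftrightarrow>
        occupancy n S (h # w) 0 g \<in> {0, 1} \<and> (\<forall>t\<le>length w. occupancy n S (h # w) (Suc t) g \<in> {0, 1})"
        by (metis Suc_le_mono not0_implies_Suc zero_le)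
      then show ?thesis using occ[OF that] by simp
    qed
    have "reaches n S (h # w) S' \<longleftrightarrow> reaches n ?S w S'" using True by simp
    also have "\<dots> \<longleftrightarrow> set (h # w) \<subseteq> {..<n} \<and> S' \<subseteq> {..<n} \<and>
      (\<forall>g<n. (\<forall>t\<le>length (h # w). occupancy n S (h # w) t g \<in> {0, 1}) \<and>
        occupancy n S (h # w) (length (h # w)) g = of_bool (g \<in> S'))"
      unfolding Cons.IH[OF sub] using all occ True by simp
    finally show ?thesis .
  next
    case False
    have no: "\<not> reaches n S (h # w) S'" using False Cons.prems by auto
    have "False" if h: "h < n" and occ: "\<forall>g<n. occupancy n S (h # w) (Suc 0) g \<in> {0, 1}"
    proof -
      have "prev_string n h \<noteq> h" "next_string n h \<noteq> h"
        using prev_string_neq next_string_neq n h by blast+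
      moreover have "occupancy n S (h # w) (Suc 0) h \<in> {0, 1}"
        "occupancy n S (h # w) (Suc 0) (next_string n h) \<in> {0, 1}"
        using occ h next_string_less by blast+
      ultimately have "h \<in> S \<and> next_string n h \<notin> S"
        using prev_next_string[OF h] by (cases "h \<in> S"; cases "next_string n h \<in> S") (simp_all add: occupancy_def)
      then show False using False h by blast
    qed
    then have "\<not> (set (h # w) \<subseteq> {..<n} \<and> (\<forall>g<n. \<forall>t\<le>length (h # w). occupancy n S (h # w) t g \<in> {0, 1}))"
      by (metis Suc_le_mono insert_subset lessThan_iff list.set(2) list.size(4) add_Suc_right add_0_right zero_le One_nat_def)
    then show ?thesis using no by blast
  qed
qed

definition below :: "nat \<Rightarrow> (nat \<Rightarrow> nat) \<Rightarrow> nat \<Rightarrow> nat" where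
  "below k t s = card {j. j < k \<and> t j < s}"

lemma less_below_iff:
  assumes "strict_mono_on {..<k} t"
  shows "j < below k t s \<longleftrightarrow> j < k \<and> t j < s"
proof -
  let ?D = "{j. j < k \<and> t j < s}"
  have down: "i \<in> ?D" if "j \<in> ?D" "i < j" for i j
    using that strict_mono_onD[OF assms, of i j] by auto
  have "\<exists>m. ?D = {..<m}"
  proof (cases "?D = {}")
    case True
    then show ?thesis by (intro exI[of _ 0]) simp
  next
    case False
    have fin: "finite ?D" by simp
    have "?D = {..<Suc (Max ?D)}"
    proof (intro set_eqI iffI)
      fix i assume "i \<in> ?D" then show "i \<in> {..<Suc (Max ?D)}" using Max_ge[OF fin] by (simp add: less_Suc_eq_le)
    next
      fix i assume "i \<in> {..<Suc (Max ?D)}"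
      then show "i \<in> ?D" using down[OF Max_in[OF fin False], of i] Max_in[OF fin False]
        unfolding lessThan_iff less_Suc_eq by metis
    qed
    then show ?thesis by blast
  qed
  then obtain m where m: "?D = {..<m}" by blast
  then have "below k t s = m" by (simp add: below_def)
  then show ?thesis using m by blast
qed

text \<open>Compare the counting functions of the two sequences instead of the sequences: for increasing
  sequences \<open>t j < s\<close> says that the count of \<open>t\<close> below \<open>s\<close> exceeds \<open>j\<close>.\<close>

lemma shifted_le_iff_below:
  assumes t: "strict_mono_on {..<k} t" and u: "strict_mono_on {..<k} u" and uN: "\<And>j. j < k \<Longrightarrow> u j < N"
  shows "(\<forall>j. j + d < k \<longrightarrow> u j \<le> t (j + d)) \<longleftrightarrow> (\<forall>s\<le>N. below k t s \<le> below k u s + d)"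
proof (intro iffI allI impI)
  fix s assume *: "\<forall>j. j + d < k \<longrightarrow> u j \<le> t (j + d)"
  show "below k t s \<le> below k u s + d"
  proof (rule ccontr)
    assume "\<not> below k t s \<le> below k u s + d"
    then have "below k u s + d < k" "t (below k u s + d) < s"
      using less_below_iff[OF t, of "below k u s + d" s] by auto
    then have "below k u s < below k u s"
      using * less_below_iff[OF u, of "below k u s" s] by fastforce
    then show False by simp
  qed
next
  fix j assume *: "\<forall>s\<le>N. below k t s \<le> below k u s + d" and j: "j + d < k"
  show "u j \<le> t (j + d)"
  proof (rule ccontr)
    assume "\<not> u j \<le> t (j + d)"
    then have "j + d < below k t (u j)" using j less_below_iff[OF t] by simp
    also have "\<dots> \<le> below k u (u j) + d" using * uN[of j] j by simp
    finally have "j < below k u (u j)" by simp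
    then show False using less_below_iff[OF u] by blast
  qed
qed

text \<open>The two alternatives of interlacing are the two ways in which the occupancy of the site between
  two strings can stay in \<open>{0, 1}\<close>: starting from an empty or from an occupied site. Without common
  values, weak and strict inequalities between the sequences agree.\<close>

lemma interlacing_below:
  fixes t u :: "nat \<Rightarrow> nat"
  assumes t: "strict_mono_on {..<k} t" and u: "strict_mono_on {..<k} u"
    and N: "\<And>j. j < k \<Longrightarrow> t j < N" "\<And>j. j < k \<Longrightarrow> u j < N"
    and neq: "\<And>i j. i < k \<Longrightarrow> j < k \<Longrightarrow> t i \<noteq> u j"
  shows "(\<forall>j<k. t j \<le> u j) \<and> (\<forall>j. j + 1 < k \<longrightarrow> u j < t (j + 1)) \<longleftrightarrow>
      (\<forall>s\<le>N. int (below k t s) - int (below k u s) \<in> {0, 1})" (is "?A1 \<longleftrightarrow> ?B1")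
    and "(\<forall>j<k. u j < t j) \<and> (\<forall>j. j + 1 < k \<longrightarrow> t j \<le> u (j + 1)) \<longleftrightarrow>
      (\<forall>s\<le>N. 1 + int (below k t s) - int (below k u s) \<in> {0, 1})" (is "?A2 \<longleftrightarrow> ?B2")
proof -
  have lt: "u i < t j \<longleftrightarrow> u i \<le> t j" if "i < k" "j < k" for i j
    using neq[OF that(2,1)] by linarith
  note 1 = shifted_le_iff_below[OF u t N(1)] shifted_le_iff_below[OF t u N(2)]
  have "?A1 \<longleftrightarrow> (\<forall>j. j + 0 < k \<longrightarrow> t j \<le> u (j + 0)) \<and> (\<forall>j. j + 1 < k \<longrightarrow> u j \<le> t (j + 1))"
    using lt by auto
  also have "\<dots> \<longleftrightarrow> (\<forall>s\<le>N. below k u s \<le> below k t s + 0) \<and> (\<forall>s\<le>N. below k t s \<le> below k u s + 1)"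
    by (simp only: 1)
  also have "\<dots> \<longleftrightarrow> ?B1"
  proof -
    have "int x - int y \<in> {0, 1} \<longleftrightarrow> y \<le> x + 0 \<and> x \<le> y + 1" for x y :: nat by auto
    then show ?thesis by (simp only:) blast
  qed
  finally show "?A1 \<longleftrightarrow> ?B1" .
  have "?A2 \<longleftrightarrow> (\<forall>j. j + 0 < k \<longrightarrow> u j \<le> t (j + 0)) \<and> (\<forall>j. j + 1 < k \<longrightarrow> t j \<le> u (j + 1))"
    using lt by auto
  also have "\<dots> \<longleftrightarrow> (\<forall>s\<le>N. below k t s \<le> below k u s + 0) \<and> (\<forall>s\<le>N. below k u s \<le> below k t s + 1)"
    by (simp only: 1)
  also have "\<dots> \<longleftrightarrow> ?B2"
  proof -
    have "1 + int x - int y \<in> {0, 1} \<longleftrightarrow> x \<le> y + 0 \<and> y \<le> x + 1" for x y :: nat by auto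
    then show ?thesis by (simp only:) blast
  qed
  finally show "?A2 \<longleftrightarrow> ?B2" .
qed

section \<open>Bead rankings and closed words\<close>

abbreviation bead_labels :: "nat \<Rightarrow> nat \<Rightarrow> (nat \<times> nat) set" where
  "bead_labels n k \<equiv> {0..<n} \<times> {0..<k}"

definition ordered_rankings :: "nat \<Rightarrow> nat \<Rightarrow> (nat \<times> nat \<Rightarrow> nat) set" where
  "ordered_rankings n k =
     {\<sigma> \<in> rankings (bead_labels n k). \<forall>h<n. strict_mono_on {..<k} (\<lambda>j. \<sigma> (h, j))}"

text \<open>The labels of the strings in the order in which their beads occur.\<close>

definition string_word :: "nat \<Rightarrow> nat \<Rightarrow> (nat \<times> nat \<Rightarrow> nat) \<Rightarrow> nat list" where
  "string_word n k \<sigma> = map (\<lambda>s. fst (inv_into (bead_labels n k) \<sigma> s)) [0..<n * k]"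

lemma ordered_rankings_bij_betw:
  assumes "\<sigma> \<in> ordered_rankings n k"
  shows "bij_betw \<sigma> (bead_labels n k) {..<n * k}"
  using rankings_bij_betw[of "bead_labels n k" \<sigma>] assms by (simp add: ordered_rankings_def)

lemma ordered_rankings_less:
  assumes "\<sigma> \<in> ordered_rankings n k" "h < n" "j < k"
  shows "\<sigma> (h, j) < n * k"
  using bij_betwE[OF ordered_rankings_bij_betw[OF assms(1)]] assms by auto

lemma length_string_word [simp]: "length (string_word n k \<sigma>) = n * k"
  by (simp add: string_word_def)

lemma string_word_nth:
  assumes "\<sigma> \<in> ordered_rankings n k" "h < n" "j < k"
  shows "string_word n k \<sigma> ! \<sigma> (h, j) = h"
  using ordered_rankings_less[OF assms] assms
    bij_betw_inv_into_left[OF ordered_rankings_bij_betw[OF assms(1)], of "(h, j)"]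
  by (simp add: string_word_def)

lemma string_word_nth_eq_iff:
  assumes \<sigma>: "\<sigma> \<in> ordered_rankings n k" and s: "s < n * k" and h: "h < n"
  shows "string_word n k \<sigma> ! s = h \<longleftrightarrow> (\<exists>j<k. \<sigma> (h, j) = s)"
proof -
  have "s \<in> \<sigma> ` bead_labels n k"
    using bij_betw_imp_surj_on[OF ordered_rankings_bij_betw[OF \<sigma>]] s by simp
  then obtain h' j' where "h' < n" "j' < k" "s = \<sigma> (h', j')" by auto
  then show ?thesis using string_word_nth[OF \<sigma>] h by metis
qed

lemma set_string_word:
  assumes \<sigma>: "\<sigma> \<in> ordered_rankings n k"
  shows "set (string_word n k \<sigma>) \<subseteq> {..<n}"
proof
  fix h assume "h \<in> set (string_word n k \<sigma>)"
  then obtain s where s: "s < n * k" "string_word n k \<sigma> ! s = h" by (auto simp: in_set_conv_nth)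
  have "s \<in> \<sigma> ` bead_labels n k"
    using bij_betw_imp_surj_on[OF ordered_rankings_bij_betw[OF \<sigma>]] s by simp
  then obtain h' j' where "h' < n" "j' < k" "s = \<sigma> (h', j')" by auto
  then show "h \<in> {..<n}" using string_word_nth[OF \<sigma>] s by auto
qed

lemma count_list_take:
  assumes "t \<le> length w"
  shows "count_list (take t w) h = card {s. s < t \<and> w ! s = h}"
proof -
  have "{i. i < length (take t w) \<and> h = take t w ! i} = {s. s < t \<and> w ! s = h}"
    using assms by auto
  then show ?thesis
    by (simp add: count_list_eq_length_filter length_filter_conv_card)
qed

lemma count_string_word:
  assumes \<sigma>: "\<sigma> \<in> ordered_rankings n k" and t: "t \<le> n * k" and h: "h < n"
  shows "count_list (take t (string_word n k \<sigma>)) h = below k (\<lambda>j. \<sigma> (h, j)) t"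
proof -
  have "{s. s < t \<and> string_word n k \<sigma> ! s = h} = (\<lambda>j. \<sigma> (h, j)) ` {j. j < k \<and> \<sigma> (h, j) < t}"
  proof (intro set_eqI iffI)
    fix s assume "s \<in> {s. s < t \<and> string_word n k \<sigma> ! s = h}"
    then have s: "s < t" "s < n * k" "string_word n k \<sigma> ! s = h" using t by simp_all
    obtain j where "j < k" "\<sigma> (h, j) = s" using string_word_nth_eq_iff[OF \<sigma> s(2) h] s(3) by blast
    then show "s \<in> (\<lambda>j. \<sigma> (h, j)) ` {j. j < k \<and> \<sigma> (h, j) < t}" using s(1) by blast
  next
    fix s assume "s \<in> (\<lambda>j. \<sigma> (h, j)) ` {j. j < k \<and> \<sigma> (h, j) < t}"
    then show "s \<in> {s. s < t \<and> string_word n k \<sigma> ! s = h}"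
      using string_word_nth[OF \<sigma> h] by auto
  qed
  moreover have "inj_on (\<lambda>j. \<sigma> (h, j)) {j. j < k \<and> \<sigma> (h, j) < t}"
  proof (rule inj_onI)
    fix i j assume "i \<in> {j. j < k \<and> \<sigma> (h, j) < t}" "j \<in> {j. j < k \<and> \<sigma> (h, j) < t}" "\<sigma> (h, i) = \<sigma> (h, j)"
    then show "i = j"
      using inj_onD[OF bij_betw_imp_inj_on[OF ordered_rankings_bij_betw[OF \<sigma>]], of "(h, i)" "(h, j)"] h by simp
  qed
  ultimately show ?thesis
    using t by (simp add: count_list_take below_def card_image)
qed

lemma strict_mono_on_below_eqD:
  assumes "strict_mono_on {..<k} t" "strict_mono_on {..<k} u"
    and "\<And>s. s \<le> N \<Longrightarrow> below k t s = below k u s"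
    and j: "j < k" and N: "t j < N" "u j < N"
  shows "t j = u j"
proof -
  have "t j < s \<longleftrightarrow> u j < s" if "s \<le> N" for s
    using less_below_iff[OF assms(1), of j s] less_below_iff[OF assms(2), of j s] assms(3)[OF that] j by simp
  from this[of "t j"] this[of "u j"] N show ?thesis by simp
qed

lemma inj_on_string_word: "inj_on (string_word n k) (ordered_rankings n k)"
proof (rule inj_onI, rule ext)
  fix \<sigma> \<tau> x
  assume \<sigma>: "\<sigma> \<in> ordered_rankings n k" and \<tau>: "\<tau> \<in> ordered_rankings n k"
    and eq: "string_word n k \<sigma> = string_word n k \<tau>"
  show "\<sigma> x = \<tau> x"
  proof (cases "x \<in> bead_labels n k")
    case True
    then obtain h j where x: "x = (h, j)" "h < n" "j < k" by auto
    have "below k (\<lambda>j. \<sigma> (h, j)) s = below k (\<lambda>j. \<tau> (h, j)) s" if "s \<le> n * k" for s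
      using count_string_word[OF \<sigma> that x(2)] count_string_word[OF \<tau> that x(2)] eq by simp
    moreover have "strict_mono_on {..<k} (\<lambda>j. \<sigma> (h, j))" "strict_mono_on {..<k} (\<lambda>j. \<tau> (h, j))"
      using \<sigma> \<tau> x(2) by (simp_all add: ordered_rankings_def)
    moreover have "\<sigma> (h, j) < n * k" "\<tau> (h, j) < n * k"
      using ordered_rankings_less \<sigma> \<tau> x by simp_all
    ultimately show ?thesis
      unfolding x(1) using strict_mono_on_below_eqD[of k "\<lambda>j. \<sigma> (h, j)" "\<lambda>j. \<tau> (h, j)" "n * k" j] x(3)
      by blast
  next
    case False
    have und: "\<upsilon> x = undefined" if "\<upsilon> \<in> ordered_rankings n k" for \<upsilon>
      using that False by (intro PiE_arb[of \<upsilon> "bead_labels n k"]) (auto simp: ordered_rankings_def rankings_def)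
    show ?thesis unfolding und[OF \<sigma>] und[OF \<tau>] ..
  qed
qed

text \<open>The bead \<open>(h, j)\<close> is the \<open>j\<close>-th occurrence of the letter \<open>h\<close>.\<close>

lemma string_word_surj:
  assumes w: "length w = n * k" "set w \<subseteq> {..<n}" and count: "\<And>h. h < n \<Longrightarrow> count_list w h = k"
  shows "w \<in> string_word n k ` ordered_rankings n k"
proof -
  define P where "P h = {s. s < n * k \<and> w ! s = h}" for h
  have P: "finite (P h)" for h by (simp add: P_def)
  have cP: "card (P h) = k" if "h < n" for h
    using count_list_take[of "n * k" w h] count[OF that] w(1) by (simp add: P_def)
  define \<sigma> where "\<sigma> = (\<lambda>(h, j) \<in> bead_labels n k. sorted_list_of_set (P h) ! j)"
  have \<sigma>: "\<sigma> (h, j) = sorted_list_of_set (P h) ! j" if "h < n" "j < k" for h j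
    using that by (simp add: \<sigma>_def)
  have len: "length (sorted_list_of_set (P h)) = k" if "h < n" for h using cP that by simp
  have mem: "\<sigma> (h, j) \<in> P h" if "h < n" "j < k" for h j
    using nth_mem[of j "sorted_list_of_set (P h)"] len that P by (simp add: \<sigma>)
  have mono: "strict_mono_on {..<k} (\<lambda>j. \<sigma> (h, j))" if "h < n" for h
  proof (rule strict_mono_onI)
    fix i j assume "i \<in> {..<k}" "j \<in> {..<k}" "i < j"
    then show "\<sigma> (h, i) < \<sigma> (h, j)"
      using sorted_wrt_nth_less[OF strict_sorted_list_of_set, of i j "P h"] len that by (simp add: \<sigma>)
  qed
  have "inj_on \<sigma> (bead_labels n k)"
  proof (rule inj_onI)
    fix x y assume xy: "x \<in> bead_labels n k" "y \<in> bead_labels n k" "\<sigma> x = \<sigma> y"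
    obtain h i h' j where [simp]: "x = (h, i)" "y = (h', j)" by (metis surj_pair)
    have b: "h < n" "i < k" "h' < n" "j < k" using xy by auto
    have "h = h'" using mem[OF b(1,2)] mem[OF b(3,4)] xy(3) by (simp add: P_def)
    moreover have "i = j"
      using inj_onD[OF strict_mono_on_imp_inj_on[OF mono[OF b(1)]], of i j] xy(3) b \<open>h = h'\<close> by simp
    ultimately show "x = y" by simp
  qed
  moreover have "\<sigma> \<in> bead_labels n k \<rightarrow>\<^sub>E {..<n * k}"
    using mem by (auto simp: PiE_iff P_def) (simp add: \<sigma>_def)
  ultimately have or: "\<sigma> \<in> ordered_rankings n k"
    using mono by (simp add: ordered_rankings_def rankings_def)
  have "string_word n k \<sigma> = w"
  proof (rule nth_equalityI)
    fix s assume "s < length (string_word n k \<sigma>)"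
    then have s: "s < n * k" by simp
    have "s \<in> \<sigma> ` bead_labels n k"
      using bij_betw_imp_surj_on[OF ordered_rankings_bij_betw[OF or]] s by simp
    then obtain h j where hj: "h < n" "j < k" "s = \<sigma> (h, j)" by auto
    then show "string_word n k \<sigma> ! s = w ! s"
      using string_word_nth[OF or hj(1,2)] mem[OF hj(1,2)] by (simp add: P_def)
  qed (use w in simp)
  then show ?thesis using or by blast
qed

text \<open>The sites that are occupied at the start: the occupation number is the number of these strings.\<close>

definition early_strings :: "nat \<Rightarrow> (nat \<times> nat \<Rightarrow> 'a::linorder) \<Rightarrow> nat set" where
  "early_strings n x = {h \<in> {0..<n}. x (h, 0) < x (prev_string n h, 0)}"

lemma below_full:
  assumes "\<And>j. j < k \<Longrightarrow> t j < N"
  shows "below k t N = k"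
proof -
  have "{j. j < k \<and> t j < N} = {..<k}" using assms by auto
  then show ?thesis by (simp add: below_def)
qed

text \<open>The occupancies along the word of a ranking are differences of counts on adjacent strings, so
  legality of the walk at site \<open>g\<close> is interlacing of the strings \<open>g - 1\<close> and \<open>g\<close>. Which of the two
  alternatives holds is decided by the first beads, that is by whether \<open>g\<close> is occupied initially.
  The walk closes up since all strings carry \<open>k\<close> beads.\<close>

lemma interlacing_iff_reaches:
  assumes n: "n \<ge> 2" and k: "k \<ge> 1" and \<sigma>: "\<sigma> \<in> ordered_rankings n k" and S: "S \<subseteq> {..<n}"
  shows "reaches n S (string_word n k \<sigma>) S \<longleftrightarrow>
    (\<forall>h<n. interlacing k (\<lambda>j. real (\<sigma> (h, j))) (\<lambda>j. real (\<sigma> (next_string n h, j)))) \<and>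
    S = early_strings n \<sigma>"
proof -
  let ?t = "\<lambda>g j. \<sigma> (prev_string n g, j)" and ?u = "\<lambda>g j. \<sigma> (g, j)"
  let ?A = "\<lambda>g. (\<forall>j<k. ?t g j \<le> ?u g j) \<and> (\<forall>j. j + 1 < k \<longrightarrow> ?u g j < ?t g (j + 1))"
  let ?B = "\<lambda>g. (\<forall>j<k. ?u g j < ?t g j) \<and> (\<forall>j. j + 1 < k \<longrightarrow> ?t g j \<le> ?u g (j + 1))"
  have occ: "occupancy n S (string_word n k \<sigma>) s g =
      of_bool (g \<in> S) + int (below k (?t g) s) - int (below k (?u g) s)" if "s \<le> n * k" "g < n" for s g
    using count_string_word[OF \<sigma> that(1)] that prev_string_less[of g n] by (simp add: occupancy_def)
  have mono: "strict_mono_on {..<k} (\<lambda>j. \<sigma> (h, j))" if "h < n" for h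
    using \<sigma> that by (simp add: ordered_rankings_def)
  have bound: "\<sigma> (h, j) < n * k" if "h < n" "j < k" for h j
    using ordered_rankings_less[OF \<sigma> that] .
  have AB: "(\<forall>s\<le>n * k. occupancy n S (string_word n k \<sigma>) s g \<in> {0, 1}) \<longleftrightarrow> (if g \<in> S then ?B g else ?A g)"
    if g: "g < n" for g
  proof -
    have p: "prev_string n g < n" "prev_string n g \<noteq> g"
      using prev_string_less prev_string_neq g n by blast+
    have neq: "?t g i \<noteq> ?u g j" if "i < k" "j < k" for i j
    proof
      assume "?t g i = ?u g j"
      then have "(prev_string n g, i) = (g, j)"
        using inj_onD[OF bij_betw_imp_inj_on[OF ordered_rankings_bij_betw[OF \<sigma>]],
            of "(prev_string n g, i)" "(g, j)"] that g p(1) by simp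
      then show False using p(2) by simp
    qed
    note ib = interlacing_below[OF mono[OF p(1)] mono[OF g] bound[OF p(1)] bound[OF g] neq]
    have "(\<forall>s\<le>n * k. occupancy n S (string_word n k \<sigma>) s g \<in> {0, 1}) \<longleftrightarrow>
      (\<forall>s\<le>n * k. of_bool (g \<in> S) + int (below k (?t g) s) - int (below k (?u g) s) \<in> {0, 1})"
      using occ g by (metis (no_types, lifting))
    also have "\<dots> \<longleftrightarrow> (if g \<in> S then ?B g else ?A g)"
      using ib by (cases "g \<in> S") (simp_all only: of_bool_eq if_True if_False add_0)
    finally show ?thesis .
  qed
  have final: "occupancy n S (string_word n k \<sigma>) (n * k) g = of_bool (g \<in> S)" if g: "g < n" for g
    using occ[OF _ g] below_full[OF bound[OF g]] below_full[OF bound[OF prev_string_less[OF g]]] by simp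
  have "reaches n S (string_word n k \<sigma>) S \<longleftrightarrow> (\<forall>g<n. if g \<in> S then ?B g else ?A g)"
    unfolding reaches_iff_occupancy[OF n S] using set_string_word[OF \<sigma>] S AB final by simp
  also have "\<dots> \<longleftrightarrow> (\<forall>g<n. (?A g \<or> ?B g) \<and> (g \<in> S \<longleftrightarrow> ?u g 0 < ?t g 0))"
  proof -
    have *: "?A g \<Longrightarrow> \<not> ?u g 0 < ?t g 0" "?B g \<Longrightarrow> ?u g 0 < ?t g 0" for g
      using k by (simp_all add: not_less)
    have "(if s then b else a) \<longleftrightarrow> (a \<or> b) \<and> (s \<longleftrightarrow> c)" if "a \<Longrightarrow> \<not> c" "b \<Longrightarrow> c" for a b c s :: bool
      using that by auto
    from this[OF *] show ?thesis by (simp only:)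
  qed
  also have "\<dots> \<longleftrightarrow> (\<forall>g<n. ?A g \<or> ?B g) \<and> S = early_strings n \<sigma>"
  proof -
    have "(\<forall>g<n. g \<in> S \<longleftrightarrow> ?u g 0 < ?t g 0) \<longleftrightarrow> S = early_strings n \<sigma>"
    proof -
      have "(\<forall>g<n. g \<in> S \<longleftrightarrow> c g) \<longleftrightarrow> S = {h \<in> {0..<n}. c h}" for c
        using S by auto
      then show ?thesis unfolding early_strings_def .
    qed
    then show ?thesis by (simp only: all_conj_distrib imp_conjR)
  qed
  also have "(\<forall>g<n. ?A g \<or> ?B g) \<longleftrightarrow>
    (\<forall>h<n. interlacing k (\<lambda>j. real (\<sigma> (h, j))) (\<lambda>j. real (\<sigma> (next_string n h, j))))" (is "?L \<longleftrightarrow> ?R")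
  proof -
    have i: "interlacing k (\<lambda>j. real (\<sigma> (prev_string n g, j))) (\<lambda>j. real (\<sigma> (g, j))) \<longleftrightarrow> ?A g \<or> ?B g" for g
      by (simp only: interlacing_def of_nat_le_iff of_nat_less_iff)
    have "?R \<longleftrightarrow> (\<forall>g<n. interlacing k (\<lambda>j. real (\<sigma> (prev_string n g, j))) (\<lambda>j. real (\<sigma> (g, j))))"
      using next_string_less prev_string_less next_prev_string prev_next_string by metis
    then show ?thesis using i by simp
  qed
  finally show ?thesis .
qed

text \<open>The occupancy of a site returns to its initial value, so the jumps into it balance the jumps out.\<close>

lemma closed_walk_counts_equal:
  assumes n: "n \<ge> 2" and S: "S \<subseteq> {..<n}" and w: "reaches n S w S" and g: "g < n"
  shows "count_list w g = count_list w 0"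
  using g
proof (induction g)
  case (Suc g)
  have "occupancy n S w (length w) (Suc g) = of_bool (Suc g \<in> S)"
    using w reaches_iff_occupancy[OF n S] Suc.prems by blast
  moreover have "prev_string n (Suc g) = g" using Suc.prems by (simp add: prev_string_eq)
  ultimately have "count_list w (Suc g) = count_list w g" by (simp add: occupancy_def)
  then show ?case using Suc by simp
qed simp

lemma length_eq_sum_count:
  assumes "set w \<subseteq> {..<n::nat}"
  shows "length w = (\<Sum>h<n. count_list w h)"
  using assms sum_count_set[of w "{..<n}"] by simp

lemma closed_walk_length:
  assumes n: "n \<ge> 2" and S: "S \<subseteq> {..<n}" and w: "reaches n S w S"
  shows "length w = n * count_list w 0"
proof -
  have "set w \<subseteq> {..<n}" using w reaches_iff_occupancy[OF n S] by blast
  then have "length w = (\<Sum>h<n. count_list w h)" by (rule length_eq_sum_count)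
  also have "\<dots> = (\<Sum>h<n. count_list w 0)"
    by (rule sum.cong[OF refl]) (rule closed_walk_counts_equal[OF n S w], simp only: lessThan_iff)
  finally show ?thesis by simp
qed

lemma walks_not_dvd:
  assumes n: "n \<ge> 2" and S: "S \<subseteq> {..<n}" and m: "\<not> n dvd m"
  shows "walks n m S S = 0"
proof -
  have none: "{w. length w = m \<and> reaches n S w S} = {}"
    using closed_walk_length[OF n S] m by auto
  then show ?thesis
    using card_reaches[OF finite_subset[OF S finite_lessThan], of m n S] unfolding none by simp
qed

text \<open>A closed walk of length \<open>n * k\<close> uses every letter \<open>k\<close> times, hence is the word of a ranking.\<close>

theorem card_interlacing_rankings:
  assumes n: "n \<ge> 2" and k: "k \<ge> 1"
  shows "card {\<sigma> \<in> ordered_rankings n k.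
      (\<forall>h<n. interlacing k (\<lambda>j. real (\<sigma> (h, j))) (\<lambda>j. real (\<sigma> (next_string n h, j)))) \<and>
      card (early_strings n \<sigma>) = l} =
    (\<Sum>S | S \<subseteq> {..<n} \<and> card S = l. walks n (n * k) S S)"
proof -
  let ?il = "\<lambda>\<sigma>. \<forall>h<n. interlacing k (\<lambda>j. real (\<sigma> (h, j))) (\<lambda>j. real (\<sigma> (next_string n h, j)))"
  let ?X = "\<lambda>S. {\<sigma> \<in> ordered_rankings n k. reaches n S (string_word n k \<sigma>) S}"
  let ?SS = "{S. S \<subseteq> {..<n} \<and> card S = l}"
  have fin: "finite (ordered_rankings n k)"
    using finite_rankings[of "bead_labels n k"] by (auto simp: ordered_rankings_def)
  have es: "early_strings n \<sigma> \<subseteq> {..<n}" for \<sigma> :: "nat \<times> nat \<Rightarrow> nat" by (auto simp: early_strings_def)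
  have eq: "{\<sigma> \<in> ordered_rankings n k. ?il \<sigma> \<and> card (early_strings n \<sigma>) = l} = (\<Union>S\<in>?SS. ?X S)"
    using interlacing_iff_reaches[OF n k] es by blast
  have "card (\<Union>S\<in>?SS. ?X S) = (\<Sum>S\<in>?SS. card (?X S))"
  proof (rule card_UN_disjoint)
    show "finite ?SS" by simp
    show "\<forall>S\<in>?SS. finite (?X S)" using fin by simp
    show "\<forall>S\<in>?SS. \<forall>S'\<in>?SS. S \<noteq> S' \<longrightarrow> ?X S \<inter> ?X S' = {}"
    proof (intro ballI impI equals0I)
      fix S S' \<sigma> assume S: "S \<in> ?SS" "S' \<in> ?SS" "S \<noteq> S'" and \<sigma>: "\<sigma> \<in> ?X S \<inter> ?X S'"
      have "S = early_strings n \<sigma>" "S' = early_strings n \<sigma>"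
        using interlacing_iff_reaches[OF n k, of \<sigma> S] interlacing_iff_reaches[OF n k, of \<sigma> S'] S(1,2) \<sigma>
        by simp_all
      then show False using S(3) by simp
    qed
  qed
  also have "\<dots> = (\<Sum>S\<in>?SS. walks n (n * k) S S)"
  proof (rule sum.cong[OF refl])
    fix S assume "S \<in> ?SS"
    then have S: "S \<subseteq> {..<n}" by simp
    have "bij_betw (string_word n k) (?X S) {w. length w = n * k \<and> reaches n S w S}"
      unfolding bij_betw_def
    proof
      show "inj_on (string_word n k) (?X S)" using inj_on_string_word by (rule inj_on_subset) blast
      show "string_word n k ` ?X S = {w. length w = n * k \<and> reaches n S w S}"
      proof (intro set_eqI iffI)
        fix w assume w: "w \<in> {w. length w = n * k \<and> reaches n S w S}"
        then have r: "reaches n S w S" "length w = n * k" by simp_all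
        have "n * k = n * count_list w 0" using closed_walk_length[OF n S r(1)] r(2) by simp
        then have "count_list w 0 = k" using n by simp
        then have "count_list w h = k" if "h < n" for h
          using closed_walk_counts_equal[OF n S r(1) that] by simp
        moreover have "set w \<subseteq> {..<n}" using r(1) reaches_iff_occupancy[OF n S] by blast
        ultimately have "w \<in> string_word n k ` ordered_rankings n k"
          using r(2) by (intro string_word_surj)
        then show "w \<in> string_word n k ` ?X S" using r(1) by blast
      qed auto
    qed
    then show "card (?X S) = walks n (n * k) S S"
      using card_reaches[OF finite_subset[OF S finite_lessThan]] by (simp add: bij_betw_same_card)
  qed
  finally show ?thesis unfolding eq .
qed

section \<open>Volumes of bead configurations\<close>

text \<open>The conditions on a bead configuration in terms of its array. They compare coordinates of beads with
  each other and nothing else, so they depend on the order of the coordinates only.\<close>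

definition bead_array_conditions :: "nat \<Rightarrow> nat \<Rightarrow> nat \<Rightarrow> (nat \<times> nat \<Rightarrow> real) \<Rightarrow> bool" where
  "bead_array_conditions n k l x \<longleftrightarrow>
     (\<forall>h<n. strict_mono_on {..<k} (\<lambda>j. x (h, j))) \<and>
     (\<forall>h<n. interlacing k (\<lambda>j. x (h, j)) (\<lambda>j. x (next_string n h, j))) \<and>
     card (early_strings n x) = l"

lemma interlacing_cong:
  assumes "\<And>j. j < k \<Longrightarrow> t j = t' j" "\<And>j. j < k \<Longrightarrow> u j = u' j"
  shows "interlacing k t u \<longleftrightarrow> interlacing k t' u'"
  using assms by (simp add: interlacing_def cong: conj_cong imp_cong)

lemma sorted_list_of_strict_mono_image:
  fixes f :: "nat \<Rightarrow> real"
  assumes "strict_mono_on {..<k} f"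
  shows "sorted_list_of_set (f ` {..<k}) = map f [0..<k]"
proof -
  have "sorted_wrt (<) (map f [0..<k])"
    using strict_mono_onD[OF assms] by (auto simp: sorted_wrt_iff_nth_less)
  moreover have "set (map f [0..<k]) = f ` {..<k}" by (simp add: atLeast0LessThan)
  ultimately show ?thesis
    by (metis List.finite_set sorted_list_of_set.idem_if_sorted_distinct strict_sorted_iff sorted_list_of_set_sort_remdups
        sorted_list_of_set.sorted_key_list_of_set_unique)
qed

lemma Min_eq_nth_0:
  fixes A :: "real set"
  assumes "finite A" "A \<noteq> {}"
  shows "Min A = sorted_list_of_set A ! 0"
  using sorted_list_of_set_nonempty[OF assms] by simp

lemma bead_arrays_eq:
  assumes k: "k \<ge> 1"
  shows "bead_array n k ` {B. bead_configuration n k B \<and> occupation_number n B = l} =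
    {x \<in> bead_labels n k \<rightarrow>\<^sub>E {0..<1}. bead_array_conditions n k l x}"
proof (intro set_eqI iffI)
  fix x assume "x \<in> bead_array n k ` {B. bead_configuration n k B \<and> occupation_number n B = l}"
  then obtain B where B: "bead_configuration n k B" "occupation_number n B = l" and x: "x = bead_array n k B"
    by blast
  have fin: "finite (coords B h)" and card: "card (coords B h) = k" if "h < n" for h
    using B(1) that by (simp_all add: bead_configuration_def)
  have xv: "x (h, j) = bead_pos B h j" if "h < n" "j < k" for h j
    using that by (simp add: x bead_array_def)
  have len: "length (sorted_list_of_set (coords B h)) = k" if "h < n" for h
    using card[OF that] by simp
  have "bead_pos B h j \<in> {0..<1}" if "h < n" "j < k" for h j
  proof -
    have "bead_pos B h j \<in> coords B h"
      unfolding bead_pos_def using nth_mem[of j "sorted_list_of_set (coords B h)"] that len fin by simp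
    then have "(bead_pos B h j, h) \<in> B" by (simp add: coords_def)
    then show ?thesis using B(1) unfolding bead_configuration_def by blast
  qed
  then have "x \<in> bead_labels n k \<rightarrow>\<^sub>E {0..<1}"
    unfolding x bead_array_def by (intro restrict_PiE_iff[THEN iffD2]) auto
  moreover have "strict_mono_on {..<k} (\<lambda>j. x (h, j))" if h: "h < n" for h
  proof (rule strict_mono_onI)
    fix i j assume "i \<in> {..<k}" "j \<in> {..<k}" "i < j"
    then show "x (h, i) < x (h, j)"
      using sorted_wrt_nth_less[OF strict_sorted_list_of_set, of i j "coords B h"] len[OF h] h
      by (simp add: xv bead_pos_def)
  qed
  moreover have "interlacing k (\<lambda>j. x (h, j)) (\<lambda>j. x (next_string n h, j))" if h: "h < n" for h
  proof -
    have "interlacing k (bead_pos B h) (bead_pos B (next_string n h))"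
      using B(1) h by (simp add: bead_configuration_def)
    then show ?thesis
      using interlacing_cong[of k "\<lambda>j. x (h, j)" "bead_pos B h" "\<lambda>j. x (next_string n h, j)"
          "bead_pos B (next_string n h)"] xv h next_string_less[OF h] by blast
  qed
  moreover have "early_strings n x = {h \<in> {0..<n}. Min (coords B h) < Min (coords B (prev_string n h))}"
  proof -
    have M: "Min (coords B h) = x (h, 0)" if "h < n" for h
    proof -
      have "coords B h \<noteq> {}" using card[OF that] k by auto
      then show ?thesis using Min_eq_nth_0[OF fin[OF that]] xv[OF that, of 0] k by (simp add: bead_pos_def)
    qed
    show ?thesis
      unfolding early_strings_def using M prev_string_less by (intro Collect_cong) auto
  qed
  ultimately show "x \<in> {x \<in> bead_labels n k \<rightarrow>\<^sub>E {0..<1}. bead_array_conditions n k l x}"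
    using B(2) by (simp add: bead_array_conditions_def occupation_number_def)
next
  fix x assume "x \<in> {x \<in> bead_labels n k \<rightarrow>\<^sub>E {0..<1}. bead_array_conditions n k l x}"
  then have x: "x \<in> bead_labels n k \<rightarrow>\<^sub>E {0..<1}"
    and mono: "\<And>h. h < n \<Longrightarrow> strict_mono_on {..<k} (\<lambda>j. x (h, j))"
    and il: "\<And>h. h < n \<Longrightarrow> interlacing k (\<lambda>j. x (h, j)) (\<lambda>j. x (next_string n h, j))"
    and es: "card (early_strings n x) = l"
    by (simp_all add: bead_array_conditions_def)
  define B where "B = (\<lambda>(h, j). (x (h, j), h)) ` bead_labels n k"
  have c: "coords B h = (\<lambda>j. x (h, j)) ` {..<k}" if "h < n" for h
    using that by (force simp: coords_def B_def image_iff)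
  have pos: "bead_pos B h j = x (h, j)" if "h < n" "j < k" for h j
    unfolding bead_pos_def c[OF that(1)] sorted_list_of_strict_mono_image[OF mono[OF that(1)]]
    using that by simp
  have "B \<subseteq> {0..<1} \<times> {0..<n}"
    unfolding B_def using PiE_mem[OF x] by auto
  moreover have "finite (coords B h) \<and> card (coords B h) = k" if "h < n" for h
    using strict_mono_on_imp_inj_on[OF mono[OF that]] by (simp add: c[OF that] card_image)
  moreover have "interlacing k (bead_pos B h) (bead_pos B (next_string n h))" if h: "h < n" for h
    using il[OF h] interlacing_cong[of k "\<lambda>j. x (h, j)" "bead_pos B h" "\<lambda>j. x (next_string n h, j)"
          "bead_pos B (next_string n h)"] pos h next_string_less[OF h] by metis
  ultimately have conf: "bead_configuration n k B" by (simp add: bead_configuration_def)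
  have M: "Min (coords B h) = x (h, 0)" if "h < n" for h
    using Min_eq_nth_0[of "coords B h"] pos[OF that, of 0] k c[OF that]
    by (simp add: bead_pos_def lessThan_empty_iff)
  have "{h \<in> {0..<n}. Min (coords B h) < Min (coords B (prev_string n h))} = early_strings n x"
    unfolding early_strings_def using M prev_string_less by (intro Collect_cong) auto
  then have "occupation_number n B = l" using es by (simp add: occupation_number_def)
  moreover have "x = bead_array n k B"
  proof
    fix i show "x i = bead_array n k B i"
      using pos PiE_arb[OF x, of i] by (cases "i \<in> bead_labels n k") (auto simp: bead_array_def)
  qed
  ultimately show "x \<in> bead_array n k ` {B. bead_configuration n k B \<and> occupation_number n B = l}"
    using conf by blast
qed

lemma bead_array_conditions_order:
  fixes x y :: "nat \<times> nat \<Rightarrow> real"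
  assumes k: "k \<ge> 1"
    and xy: "\<And>i j. i \<in> bead_labels n k \<Longrightarrow> j \<in> bead_labels n k \<Longrightarrow> x i < x j \<longleftrightarrow> y i < y j"
    and x: "bead_array_conditions n k l x"
  shows "bead_array_conditions n k l y"
proof -
  have lt: "x (h, i) < x (h', j) \<longleftrightarrow> y (h, i) < y (h', j)" if "h < n" "h' < n" "i < k" "j < k" for h h' i j
    using xy that by simp
  have le: "x (h, i) \<le> x (h', j) \<longleftrightarrow> y (h, i) \<le> y (h', j)" if "h < n" "h' < n" "i < k" "j < k" for h h' i j
    using lt[of h' h j i] that by (simp add: not_less[symmetric])
  have "strict_mono_on {..<k} (\<lambda>j. y (h, j))" if h: "h < n" for h
  proof (rule strict_mono_onI)
    fix i j assume ij: "i \<in> {..<k}" "j \<in> {..<k}" "i < j"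
    have "strict_mono_on {..<k} (\<lambda>j. x (h, j))" using x h by (simp add: bead_array_conditions_def)
    from strict_mono_onD[OF this ij] show "y (h, i) < y (h, j)" using lt[OF h h] ij by simp
  qed
  moreover have "interlacing k (\<lambda>j. y (h, j)) (\<lambda>j. y (next_string n h, j))" if h: "h < n" for h
  proof -
    have "interlacing k (\<lambda>j. x (h, j)) (\<lambda>j. x (next_string n h, j))"
      using x h by (simp add: bead_array_conditions_def)
    then show ?thesis
      using lt[OF h next_string_less[OF h]] lt[OF next_string_less[OF h] h]
        le[OF h next_string_less[OF h]] le[OF next_string_less[OF h] h]
      by (simp add: interlacing_def)
  qed
  moreover have "early_strings n y = early_strings n x"
    unfolding early_strings_def using lt prev_string_less k by (intro Collect_cong) auto
  ultimately show ?thesis using x by (simp add: bead_array_conditions_def)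
qed

text \<open>The condition on the occupation number is a finite union, over the possible sets of early strings,
  of finite intersections of half-spaces.\<close>

lemma sets_bead_arrays:
  assumes k: "k \<ge> 1"
  shows "{x \<in> bead_labels n k \<rightarrow>\<^sub>E {0..<1}. bead_array_conditions n k l x} \<in>
    sets (lebesgue_on_arrays (bead_labels n k))"
proof -
  let ?I = "bead_labels n k"
  let ?M = "lebesgue_on_arrays ?I"
  have fI: "finite ?I" by simp
  have lt: "{x \<in> space ?M. x i < x j} \<in> sets ?M" if "i \<in> ?I" "j \<in> ?I" for i j
    by (rule measurable_coordinate_less[OF fI that])
  have le: "{x \<in> space ?M. x i \<le> x j} \<in> sets ?M" if "i \<in> ?I" "j \<in> ?I" for i j
    unfolding not_less[symmetric] using lt[OF that(2,1)] by (rule sets.sets_Collect_neg)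
  have mono: "{x \<in> space ?M. \<forall>h\<in>{..<n}. \<forall>i\<in>{..<k}. \<forall>j\<in>{..<k}. i < j \<longrightarrow> x (h, i) < x (h, j)} \<in> sets ?M"
    by (intro sets.sets_Collect_finite_All sets.sets_Collect_imp lt sets.sets_Collect_const) auto
  have il: "{x \<in> space ?M. \<forall>h\<in>{..<n}.
      (\<forall>j\<in>{..<k}. x (h, j) \<le> x (next_string n h, j)) \<and>
        (\<forall>j\<in>{..<k-1}. x (next_string n h, j) < x (h, j + 1)) \<or>
      (\<forall>j\<in>{..<k}. x (next_string n h, j) < x (h, j)) \<and>
        (\<forall>j\<in>{..<k-1}. x (h, j) \<le> x (next_string n h, j + 1))} \<in> sets ?M"
    using next_string_less
    by (intro sets.sets_Collect_finite_All sets.sets_Collect_conj sets.sets_Collect_disj lt le) auto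
  have es: "{x \<in> space ?M. \<exists>S\<in>{S. S \<subseteq> {..<n} \<and> card S = l}. \<forall>h\<in>{..<n}.
      if h \<in> S then x (h, 0) < x (prev_string n h, 0) else x (prev_string n h, 0) \<le> x (h, 0)} \<in> sets ?M"
  proof (intro sets.sets_Collect_finite_Ex sets.sets_Collect_finite_All)
    fix S h assume "h \<in> {..<n}"
    then have "(h, 0) \<in> ?I" "(prev_string n h, 0) \<in> ?I" using k prev_string_less by auto
    then show "{x \<in> space ?M. if h \<in> S then x (h, 0) < x (prev_string n h, 0)
        else x (prev_string n h, 0) \<le> x (h, 0)} \<in> sets ?M"
      using lt le by (cases "h \<in> S") simp_all
  qed auto
  have es_iff: "card (early_strings n x) = l \<longleftrightarrow> (\<exists>S\<in>{S. S \<subseteq> {..<n} \<and> card S = l}. \<forall>h\<in>{..<n}.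
      if h \<in> S then x (h, 0) < x (prev_string n h, 0) else x (prev_string n h, 0) \<le> x (h, 0))"
    for x :: "nat \<times> nat \<Rightarrow> real"
  proof
    assume "card (early_strings n x) = l"
    then show "\<exists>S\<in>{S. S \<subseteq> {..<n} \<and> card S = l}. \<forall>h\<in>{..<n}.
      if h \<in> S then x (h, 0) < x (prev_string n h, 0) else x (prev_string n h, 0) \<le> x (h, 0)"
      by (intro bexI[of _ "early_strings n x"]) (auto simp: early_strings_def)
  next
    assume "\<exists>S\<in>{S. S \<subseteq> {..<n} \<and> card S = l}. \<forall>h\<in>{..<n}.
      if h \<in> S then x (h, 0) < x (prev_string n h, 0) else x (prev_string n h, 0) \<le> x (h, 0)"
    then obtain S where S: "S \<subseteq> {..<n}" "card S = l" "\<And>h. h < n \<Longrightarrow>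
      if h \<in> S then x (h, 0) < x (prev_string n h, 0) else x (prev_string n h, 0) \<le> x (h, 0)" by auto
    have "h \<in> S \<longleftrightarrow> x (h, 0) < x (prev_string n h, 0)" if "h < n" for h
      using S(3)[OF that] by (cases "h \<in> S") simp_all
    then have "early_strings n x = S" using S(1) by (auto simp: early_strings_def)
    then show "card (early_strings n x) = l" using S(2) by simp
  qed
  have il_iff: "interlacing k t u \<longleftrightarrow>
      (\<forall>j\<in>{..<k}. t j \<le> u j) \<and> (\<forall>j\<in>{..<k-1}. u j < t (j + 1)) \<or>
      (\<forall>j\<in>{..<k}. u j < t j) \<and> (\<forall>j\<in>{..<k-1}. t j \<le> u (j + 1))" for t u
    by (simp only: interlacing_def less_diff_conv Ball_def lessThan_iff)
  have mono_iff: "strict_mono_on {..<k} t \<longleftrightarrow> (\<forall>i\<in>{..<k}. \<forall>j\<in>{..<k}. i < j \<longrightarrow> t i < t j)" for t :: "nat \<Rightarrow> real"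
    by (auto intro: strict_mono_onI dest: strict_mono_onD)
  have ball: "(\<forall>h<n. P h) \<longleftrightarrow> (\<forall>h\<in>{..<n}. P h)" for P by auto
  have "{x \<in> space ?M. bead_array_conditions n k l x} \<in> sets ?M"
    unfolding bead_array_conditions_def es_iff il_iff mono_iff ball
    by (intro sets.sets_Collect_conj mono il es)
  then have "(?I \<rightarrow>\<^sub>E {0..<1}) \<inter> {x \<in> space ?M. bead_array_conditions n k l x} \<in> sets ?M"
    by (rule sets.Int[OF sets_cube[OF fI]])
  also have "(?I \<rightarrow>\<^sub>E {0..<1}) \<inter> {x \<in> space ?M. bead_array_conditions n k l x} =
      {x \<in> ?I \<rightarrow>\<^sub>E {0..<1}. bead_array_conditions n k l x}"
    using sets.sets_into_space[OF sets_cube[OF fI]] by blast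
  finally show ?thesis .
qed

theorem Vol_eq_walks:
  assumes n: "n \<ge> 2"
  shows "Vol n k l = real (\<Sum>S | S \<subseteq> {..<n} \<and> card S = l. walks n (n * k) S S) / fact (n * k)"
proof (cases "k = 0")
  case True
  then show ?thesis using n_subsets[of "{..<n}" l] by (simp add: Vol_def)
next
  case False
  then have k: "k \<ge> 1" by simp
  let ?I = "bead_labels n k"
  have "Vol n k l = measure (lebesgue_on_arrays ?I) {x \<in> ?I \<rightarrow>\<^sub>E {0..<1}. bead_array_conditions n k l x}"
    unfolding Vol_def using False by (simp only: if_False bead_arrays_eq[OF k])
  also have "\<dots> = card {\<sigma> \<in> rankings ?I. bead_array_conditions n k l (\<lambda>i. real (\<sigma> i))} / fact (card ?I)"
  proof (rule measure_order_invariant)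
    show "finite ?I" by simp
    show "{x \<in> ?I \<rightarrow>\<^sub>E {0..<1}. bead_array_conditions n k l x} \<in> sets (lebesgue_on_arrays ?I)"
      by (rule sets_bead_arrays[OF k])
  qed (rule bead_array_conditions_order[OF k])
  also have "{\<sigma> \<in> rankings ?I. bead_array_conditions n k l (\<lambda>i. real (\<sigma> i))} =
    {\<sigma> \<in> ordered_rankings n k.
      (\<forall>h<n. interlacing k (\<lambda>j. real (\<sigma> (h, j))) (\<lambda>j. real (\<sigma> (next_string n h, j)))) \<and>
      card (early_strings n \<sigma>) = l}"
  proof -
    have "strict_mono_on {..<k} (\<lambda>j. real (\<sigma> (h, j))) \<longleftrightarrow> strict_mono_on {..<k} (\<lambda>j. \<sigma> (h, j))"
      and "early_strings n (\<lambda>i. real (\<sigma> i)) = early_strings n \<sigma>" for \<sigma> :: "nat \<times> nat \<Rightarrow> nat" and h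
      by (simp_all add: strict_mono_on_def early_strings_def)
    then show ?thesis
      by (simp add: bead_array_conditions_def ordered_rankings_def conj_assoc)
  qed
  finally show ?thesis unfolding card_interlacing_rankings[OF n k] by simp
qed

section \<open>The generating function\<close>

text \<open>The elementary symmetric polynomial of degree \<open>l\<close> in the numbers \<open>exp (T * z)\<close>.\<close>

definition root_exp_sum :: "nat \<Rightarrow> nat \<Rightarrow> nat \<Rightarrow> complex \<Rightarrow> complex" where
  "root_exp_sum n e l T = (\<Sum>B | B \<subseteq> roots n e \<and> card B = l. exp (T * \<Sum>B))"

lemma has_sum_exp: "((\<lambda>m. x ^ m / fact m) has_sum exp x) UNIV" for x :: complex
proof -
  have eq: "x ^ m / fact m = x ^ m /\<^sub>R fact m" for m
    by (simp add: scaleR_conv_of_real field_simps)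
  show ?thesis unfolding eq by (rule norm_summable_imp_has_sum[OF summable_norm_exp exp_converges])
qed

lemma has_sum_sum_finite:
  fixes f :: "'b \<Rightarrow> 'a \<Rightarrow> 'c :: topological_comm_monoid_add"
  assumes "finite F" "\<And>b. b \<in> F \<Longrightarrow> (f b has_sum s b) A"
  shows "((\<lambda>x. \<Sum>b\<in>F. f b x) has_sum (\<Sum>b\<in>F. s b)) A"
  using assms by (induction F rule: finite_induct) (auto intro: has_sum_add)

lemma has_sum_finite_columns:
  fixes f :: "'a \<times> 'b \<Rightarrow> 'c :: topological_comm_monoid_add"
  assumes "finite F" "\<And>b. b \<in> F \<Longrightarrow> ((\<lambda>a. f (a, b)) has_sum s b) A"
  shows "(f has_sum (\<Sum>b\<in>F. s b)) (A \<times> F)"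
  using assms
proof (induction F rule: finite_induct)
  case (insert b F)
  have "inj_on (\<lambda>a. (a, b)) A" by (auto intro: inj_onI)
  then have "(f has_sum s b) ((\<lambda>a. (a, b)) ` A)"
    using insert.prems[of b] by (simp add: has_sum_reindex o_def)
  also have "(\<lambda>a. (a, b)) ` A = A \<times> {b}" by auto
  finally have "(f has_sum (s b + (\<Sum>b\<in>F. s b))) (A \<times> {b} \<union> A \<times> F)"
    using insert by (intro has_sum_Un_disjoint) auto
  moreover have "A \<times> insert b F = A \<times> {b} \<union> A \<times> F" by auto
  ultimately show ?case using insert.hyps by simp
qed simp

text \<open>The exponential series of the trace. The terms whose degree is no multiple of \<open>n\<close> vanish, since there
  are no closed walks of such lengths.\<close>

lemma has_sum_Vol:
  assumes n: "n \<ge> 2"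
  shows "((\<lambda>k. T ^ (n * k) * of_real (Vol n k l)) has_sum root_exp_sum n (l + 1) l T) UNIV"
proof -
  let ?BB = "{B. B \<subseteq> roots n (l + 1) \<and> card B = l}"
  let ?tr = "\<lambda>m. \<Sum>S | S \<subseteq> {..<n} \<and> card S = l. walks n m S S"
  let ?f = "\<lambda>m. T ^ m * of_nat (?tr m) / fact m"
  have fin: "finite ?BB" using n by simp
  have f: "?f m = (\<Sum>B\<in>?BB. (T * \<Sum>B) ^ m / fact m)" for m
    unfolding trace_walks[OF n] by (simp only: power_mult_distrib sum_divide_distrib[symmetric] sum_distrib_left[symmetric])
  have all: "(?f has_sum root_exp_sum n (l + 1) l T) UNIV"
    unfolding f root_exp_sum_def by (rule has_sum_sum_finite[OF fin has_sum_exp])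
  have "?f m = 0" if "m \<in> UNIV - range (\<lambda>k. n * k)" for m
  proof -
    have "\<not> n dvd m" using that by (auto elim!: dvdE)
    then have "?tr m = 0" by (intro sum.neutral ballI walks_not_dvd[OF n]) auto
    then show ?thesis by simp
  qed
  then have "(?f has_sum root_exp_sum n (l + 1) l T) (range (\<lambda>k. n * k))"
    using all by (subst has_sum_cong_neutral[of UNIV _ ?f ?f]) auto
  then have "(?f \<circ> (\<lambda>k. n * k) has_sum root_exp_sum n (l + 1) l T) UNIV"
    using n by (subst (asm) has_sum_reindex) (auto intro!: inj_onI)
  moreover have "T ^ (n * k) * of_real (Vol n k l) = (?f \<circ> (\<lambda>k. n * k)) k" for k
    by (simp add: Vol_eq_walks[OF n])
  ultimately show ?thesis by (simp only:)
qed

lemma has_sum_Z_term: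
  assumes n: "n \<ge> 2"
  shows "(Z_term n lam T has_sum (\<Sum>l\<in>{0..n}. exp (- lam * of_nat l) * root_exp_sum n (l + 1) l T)) (UNIV \<times> {0..n})"
proof (rule has_sum_finite_columns)
  fix l
  show "((\<lambda>k. Z_term n lam T (k, l)) has_sum (exp (- lam * of_nat l) * root_exp_sum n (l + 1) l T)) UNIV"
    using has_sum_cmult_right[OF has_sum_Vol[OF n, of T l], of "exp (- lam * of_nat l)"]
    by (simp add: Z_term_def mult_ac)
qed simp

lemma sum_roots_eq_0:
  assumes "n \<ge> 2"
  shows "\<Sum>(roots n e) = 0"
  using sum_roots_powers[of 1 n 0 e] assms by simp

text \<open>Choosing \<open>c\<close> on a set \<open>B\<close> of roots leaves \<open>exp (T * z)\<close> on the complement, and the sum of the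
  complement is that of \<open>- B\<close> because the sum of all roots is 0. The negatives are roots for the
  exponent \<open>e + n\<close>.\<close>

lemma prod_roots_exp_add:
  assumes n: "n \<ge> 2"
  shows "(\<Prod>z\<in>roots n e. exp (T * z) + c) = (\<Sum>l\<in>{0..n}. c ^ l * root_exp_sum n (e + n) l T)"
proof -
  let ?R = "roots n e" and ?R' = "roots n (e + n)"
  have fin: "finite ?R" "finite ?R'" using n by auto
  have mem: "- z \<in> roots n d \<longleftrightarrow> z \<in> roots n (d + n)" for z d
    unfolding roots_def mem_Collect_eq power_minus[of z n] power_add
    by (cases "even n") (simp_all add: minus_equation_iff[of "z ^ n"] eq_commute)
  have neg: "uminus ` ?R = ?R'"
  proof (intro set_eqI iffI)
    fix z assume "z \<in> uminus ` ?R"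
    then obtain y where "z = - y" "- z \<in> ?R" by auto
    then show "z \<in> ?R'" using mem[of z e] by simp
  next
    fix z assume "z \<in> ?R'"
    then have "- z \<in> ?R" using mem[of z e] by simp
    then show "z \<in> uminus ` ?R" by (metis image_eqI minus_minus)
  qed
  have bij: "bij_betw ((`) uminus) (Pow ?R) (Pow ?R')"
    using neg by (intro bij_betw_Pow) (simp add: bij_betw_def inj_on_def)
  have "(\<Prod>z\<in>?R. exp (T * z) + c) = (\<Prod>z\<in>?R. c + exp (T * z))" by (simp add: add.commute)
  also have "\<dots> = (\<Sum>B\<in>Pow ?R. (\<Prod>z\<in>B. c) * (\<Prod>z\<in>?R - B. exp (T * z)))"
    by (rule prod_add[OF fin(1)])
  also have "\<dots> = (\<Sum>B\<in>Pow ?R. c ^ card (uminus ` B) * exp (T * \<Sum>(uminus ` B)))"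
  proof (rule sum.cong[OF refl])
    fix B assume "B \<in> Pow ?R"
    then have B: "B \<subseteq> ?R" by simp
    have "(\<Sum>z\<in>?R - B. z) = - \<Sum>B"
      using sum_diff[OF fin(1) B, of "\<lambda>z. z"] sum_roots_eq_0[OF n] by simp
    moreover have "\<Sum>(uminus ` B) = - \<Sum>B" by (simp add: sum.reindex sum_negf)
    moreover have "(\<Prod>z\<in>?R - B. exp (T * z)) = exp (T * (\<Sum>z\<in>?R - B. z))"
      using fin(1) by (simp add: exp_sum sum_distrib_left)
    ultimately show "(\<Prod>z\<in>B. c) * (\<Prod>z\<in>?R - B. exp (T * z)) =
        c ^ card (uminus ` B) * exp (T * \<Sum>(uminus ` B))"
      by (simp add: card_image)
  qed
  also have "\<dots> = (\<Sum>B\<in>Pow ?R'. c ^ card B * exp (T * \<Sum>B))"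
    by (rule sum.reindex_bij_betw[OF bij])
  also have "\<dots> = (\<Sum>l\<in>{0..n}. \<Sum>B | B \<in> Pow ?R' \<and> card B = l. c ^ card B * exp (T * \<Sum>B))"
  proof (rule sum.group[symmetric])
    show "card ` Pow ?R' \<subseteq> {0..n}"
      using card_mono[OF fin(2)] card_roots[of n "e + n"] n by auto
  qed (use fin in auto)
  also have "\<dots> = (\<Sum>l\<in>{0..n}. c ^ l * root_exp_sum n (e + n) l T)"
    unfolding root_exp_sum_def sum_distrib_left by (intro sum.cong) auto
  finally show ?thesis .
qed

lemma root_exp_sum_parity:
  assumes "even (d + e)"
  shows "root_exp_sum n d l T = root_exp_sum n e l T"
proof -
  have "(-1) ^ d = ((-1) ^ e :: complex)" using assms by (cases "even d") simp_all
  then show ?thesis by (simp only: root_exp_sum_def roots_def)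
qed

theorem theorem1p2:
  fixes n :: nat and lam T :: complex
  assumes "n \<ge> 2"
  shows "Z_term n lam T summable_on (UNIV \<times> {0..n}) \<and>
    Z n lam T =
      1 / 2 * (\<Sum>(\<theta>\<^sub>1, \<theta>\<^sub>2) \<in> {0, 1 :: nat} \<times> {0, 1 :: nat}.
        (-1) ^ ((\<theta>\<^sub>1 + 1) * (\<theta>\<^sub>2 + n + 1)) *
        (\<Prod>z | z ^ n = (-1) ^ \<theta>\<^sub>2. exp (T * z) - (-1) ^ \<theta>\<^sub>1 * exp (- lam)))"
proof
  let ?x = "exp (- lam)"
  let ?E = "\<lambda>e l. root_exp_sum n e l T"
  have Z: "(Z_term n lam T has_sum (\<Sum>l\<in>{0..n}. ?x ^ l * ?E (l + 1) l)) (UNIV \<times> {0..n})"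
    using has_sum_Z_term[OF assms, of lam T] by (simp add: exp_of_nat_mult[symmetric] mult.commute)
  then show "Z_term n lam T summable_on (UNIV \<times> {0..n})" by (auto simp: summable_on_def)
  \<comment> \<open>The sign in front is moved into the sum over the degree \<open>l\<close>; as \<open>\<theta>\<^sub>1\<close> varies, the factor
  \<open>((-1) ^ (\<theta>\<^sub>2 + n + 1 + l)) ^ (\<theta>\<^sub>1 + 1)\<close> averages to 1 or 0 according to the sign of its base.\<close>
  have summand: "(-1) ^ ((\<theta>\<^sub>1 + 1) * (\<theta>\<^sub>2 + n + 1)) * (\<Prod>z | z ^ n = (-1) ^ \<theta>\<^sub>2. exp (T * z) - (-1) ^ \<theta>\<^sub>1 * ?x) =
      (\<Sum>l\<in>{0..n}. ((-1) ^ (\<theta>\<^sub>2 + n + 1 + l)) ^ (\<theta>\<^sub>1 + 1) * ?x ^ l * ?E (\<theta>\<^sub>2 + n) l)" for \<theta>\<^sub>1 \<theta>\<^sub>2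
  proof -
    have "(\<Prod>z | z ^ n = (-1) ^ \<theta>\<^sub>2. exp (T * z) - (-1) ^ \<theta>\<^sub>1 * ?x) =
        (\<Prod>z\<in>roots n \<theta>\<^sub>2. exp (T * z) + (-1) ^ (\<theta>\<^sub>1 + 1) * ?x)"
      by (simp add: roots_def)
    also have "\<dots> = (\<Sum>l\<in>{0..n}. ((-1) ^ (\<theta>\<^sub>1 + 1) * ?x) ^ l * ?E (\<theta>\<^sub>2 + n) l)"
      by (rule prod_roots_exp_add[OF assms])
    finally have p: "(\<Prod>z | z ^ n = (-1) ^ \<theta>\<^sub>2. exp (T * z) - (-1) ^ \<theta>\<^sub>1 * ?x) = \<dots>" .
    have s: "(-1) ^ ((\<theta>\<^sub>1 + 1) * (\<theta>\<^sub>2 + n + 1)) * ((-1) ^ (\<theta>\<^sub>1 + 1) * ?x) ^ l =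
        ((-1) ^ (\<theta>\<^sub>2 + n + 1 + l)) ^ (\<theta>\<^sub>1 + 1) * ?x ^ l" for l
      by (simp only: power_mult_distrib power_mult[symmetric] power_add mult_ac distrib_left distrib_right)
    show ?thesis unfolding p sum_distrib_left mult.assoc[symmetric] s ..
  qed
  have "1 / 2 * (\<Sum>(\<theta>\<^sub>1, \<theta>\<^sub>2) \<in> {0, 1 :: nat} \<times> {0, 1 :: nat}.
        (-1) ^ ((\<theta>\<^sub>1 + 1) * (\<theta>\<^sub>2 + n + 1)) *
        (\<Prod>z | z ^ n = (-1) ^ \<theta>\<^sub>2. exp (T * z) - (-1) ^ \<theta>\<^sub>1 * ?x)) =
      (\<Sum>l\<in>{0..n}. ?x ^ l * (1 / 2 * (\<Sum>\<theta>\<^sub>2\<in>{0, 1}. \<Sum>\<theta>\<^sub>1\<in>{0, 1::nat}.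
        ((-1) ^ (\<theta>\<^sub>2 + n + 1 + l)) ^ (\<theta>\<^sub>1 + 1) * ?E (\<theta>\<^sub>2 + n) l)))"
    unfolding summand sum.cartesian_product[symmetric]
    by (simp add: sum.distrib sum_subtractf sum_negf sum_distrib_left algebra_simps)
  also have "\<dots> = (\<Sum>l\<in>{0..n}. ?x ^ l * ?E (l + 1) l)"
  proof (intro sum.cong refl arg_cong2[where f = "(*)"])
    fix l
    have 0: "?E n l = ?E (l + 1) l" if "even (n + 1 + l)"
      using that by (intro root_exp_sum_parity) simp
    have 1: "?E (Suc n) l = ?E (l + 1) l" if "odd (n + 1 + l)"
      using that by (intro root_exp_sum_parity) simp
    show "1 / 2 * (\<Sum>\<theta>\<^sub>2\<in>{0, 1}. \<Sum>\<theta>\<^sub>1\<in>{0, 1::nat}.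
        ((-1) ^ (\<theta>\<^sub>2 + n + 1 + l)) ^ (\<theta>\<^sub>1 + 1) * ?E (\<theta>\<^sub>2 + n) l) = ?E (l + 1) l"
      using 0 1 by (cases "even (n + 1 + l)") simp_all
  qed
  finally show "Z n lam T = 1 / 2 * (\<Sum>(\<theta>\<^sub>1, \<theta>\<^sub>2) \<in> {0, 1 :: nat} \<times> {0, 1 :: nat}.
        (-1) ^ ((\<theta>\<^sub>1 + 1) * (\<theta>\<^sub>2 + n + 1)) *
        (\<Prod>z | z ^ n = (-1) ^ \<theta>\<^sub>2. exp (T * z) - (-1) ^ \<theta>\<^sub>1 * ?x))"
    using infsumI[OF Z] by (simp only: Z_def)
qed

end
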